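(* Let $(S,\mathcal{S},\hat{\mathcal{S}})$ be a localized Borel space. Let $\xi$ be a simple signed point process on $S$ with independent increments. Then $\xi$ is a Skellam point process. Conversely, let $\eta$ be a Skellam point process on $S$. Then $\eta$ is a simple signed point process with independent increments.
   Context: A localized Borel space $(S,\mathcal{S},\hat{\mathcal{S}})$ consists of a Borel space $(S,\mathcal{S})$ and a localizing ring $\hat{\mathcal{S}}$, i.e. a ring $\hat{\mathcal{S}}\subset\mathcal{S}$ such that $B\cap C\in\hat{\mathcal{S}}$ for all $B\in\hat{\mathcal{S}}$, $C\in\mathcal{S}$, and $\hat{\mathcal{S}}=\bigcup_n(\mathcal{S}\cap S_n)$ for some sets $S_n\uparrow S$ in $\hat{\mathcal{S}}$. $\mathsf{M}_S$ is the space of countably additive set functions $\mu:\hat{\mathcal{S}}\to\mathbb{R}$ (sums over disjoint sets converging absolutely), with the $\sigma$-algebra generated by $\mu\mapsto\mu(B)$, $B\in\hat{\mathcal{S}}$; a random signed measure on $S$ is an $\mathsf{M}_S$-valued random element. It has independent increments if its values on any finitely many disjoint sets of $\hat{\mathcal{S}}$ are jointly independent. Every random signed measure can be written $\xi=\alpha_+-\alpha_-+\sum_{k\le\kappa_+}\beta_{+,k}\delta_{\sigma_{+,k}}-\sum_{k\le\kappa_-}\beta_{-,k}\delta_{\sigma_{-,k}}$ with diffuse random measures $\alpha_\pm$, random $\kappa_\pm\in\{0,1,\dots,\infty\}$, positive random weights $\beta_{\pm,k}$ and almost surely distinct random points $\sigma_{\pm,k}$ in $S$. A signed point process is a random signed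 measure for which $\alpha_\pm(S)=0$ and the weights $\beta_{\pm,k}$ take values in $\mathbb{N}$; it is simple if all weights equal $1$. The Jordan decomposition of a random signed measure $\xi$ is the pair of random (locally finite) measures $\xi_\pm$ with $\xi_+(B)=\sup_{E\in\mathcal{S},E\subset B}\xi(E)$, $\xi_-(B)=\sup_{E\in\mathcal{S},E\subset B}-\xi(E)$ for $B\in\hat{\mathcal{S}}$, so $\xi=\xi_+-\xi_-$ on $\hat{\mathcal{S}}$. A Skellam point process is a signed point process whose Jordan decomposition consists of two independent Poisson point processes.
   Formalization: In both directions the process is also assumed to have no fixed atoms (mass 0 a.s. at each point of S); otherwise, on a one-point space, a Bernoulli mass is simple with independent increments but not Skellam, and a Poisson mass is Skellam but not simple. *)

theory Defs
  imports "HOL-Probability.Probability"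
begin

definition borel_space :: "'a measure \<Rightarrow> bool" where
  "borel_space S \<longleftrightarrow>
     (\<exists>(A :: real set) f g. A \<in> sets borel \<and> A \<subseteq> {0..1} \<and>
        f \<in> S \<rightarrow>\<^sub>M restrict_space borel A \<and> g \<in> restrict_space borel A \<rightarrow>\<^sub>M S \<and>
        (\<forall>x\<in>space S. g (f x) = x) \<and> (\<forall>y\<in>A. f (g y) = y))"

text \<open>Only \<open>space S\<close> and \<open>sets S\<close> matter; the measure carried by \<open>S\<close> is ignored.\<close>

locale localized_borel_space = ring_of_sets "space S" R
  for S :: "'a measure" and R :: "'a set set" +
  assumes borel_space: "borel_space S"
    and ring_subset: "R \<subseteq> sets S"
    and Int_closed: "\<And>B C. B \<in> R \<Longrightarrow> C \<in> sets S \<Longrightarrow> B \<inter> C \<in> R"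
    and localizing_sequence:
      "\<exists>A :: nat \<Rightarrow> 'a set. range A \<subseteq> R \<and> incseq A \<and> (\<Union>n. A n) = space S \<and>
         R = (\<Union>n. {C \<inter> A n |C. C \<in> sets S})"

text \<open>Set functions with domain \<open>R\<close> are represented by the functions extensional on \<open>R\<close>; the
  product \<open>\<sigma>\<close>-algebra below is the one generated by the evaluations at the elements of \<open>R\<close>.\<close>

definition signed_measures :: "'a set set \<Rightarrow> ('a set \<Rightarrow> real) set" where
  "signed_measures R =
     {\<mu> \<in> extensional R. \<forall>A :: nat \<Rightarrow> 'a set.
        range A \<subseteq> R \<and> disjoint_family A \<and> (\<Union>n. A n) \<in> R \<longrightarrow>
        summable (\<lambda>n. \<bar>\<mu> (A n)\<bar>) \<and> (\<lambda>n. \<mu> (A n)) sums \<mu> (\<Union>n. A n)}"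

definition signed_measure_algebra :: "'a set set \<Rightarrow> ('a set \<Rightarrow> real) measure" where
  "signed_measure_algebra R = restrict_space (\<Pi>\<^sub>M B\<in>R. borel) (signed_measures R)"

definition random_signed_measure ::
    "'w measure \<Rightarrow> 'a set set \<Rightarrow> ('w \<Rightarrow> 'a set \<Rightarrow> real) \<Rightarrow> bool" where
  "random_signed_measure P R \<xi> \<longleftrightarrow> \<xi> \<in> P \<rightarrow>\<^sub>M signed_measure_algebra R"

definition independent_increments ::
    "'w measure \<Rightarrow> 'a set set \<Rightarrow> ('w \<Rightarrow> 'a set \<Rightarrow> real) \<Rightarrow> bool" where
  "independent_increments P R \<xi> \<longleftrightarrow>
     (\<forall>(n :: nat) B. (\<forall>i<n. B i \<in> R) \<and> disjoint_family_on B {..<n} \<longrightarrow>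
        prob_space.indep_vars P (\<lambda>_. borel) (\<lambda>i \<omega>. \<xi> \<omega> (B i)) {..<n})"

text \<open>The space of locally finite measures, in the style of \<^const>\<open>subprob_algebra\<close>.\<close>

definition locally_finite_algebra :: "'a measure \<Rightarrow> 'a set set \<Rightarrow> 'a measure measure" where
  "locally_finite_algebra S R =
     (SUP B \<in> R. vimage_algebra {M. sets M = sets S \<and> (\<forall>C\<in>R. emeasure M C < \<infinity>)}
        (\<lambda>M. emeasure M B) borel)"

definition random_measure ::
    "'w measure \<Rightarrow> 'a measure \<Rightarrow> 'a set set \<Rightarrow> ('w \<Rightarrow> 'a measure) \<Rightarrow> bool" where
  "random_measure P S R \<zeta> \<longleftrightarrow> \<zeta> \<in> P \<rightarrow>\<^sub>M locally_finite_algebra S R"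

definition diffuse_random_measure ::
    "'w measure \<Rightarrow> 'a measure \<Rightarrow> 'a set set \<Rightarrow> ('w \<Rightarrow> 'a measure) \<Rightarrow> bool" where
  "diffuse_random_measure P S R \<alpha> \<longleftrightarrow>
     random_measure P S R \<alpha> \<and> (AE \<omega> in P. \<forall>x\<in>space S. emeasure (\<alpha> \<omega>) {x} = 0)"

text \<open>The Boolean argument of \<open>\<alpha>\<close>, \<open>\<kappa>\<close>, \<open>\<beta>\<close>, \<open>\<sigma>\<close> is the sign (\<^const>\<open>True\<close> for \<open>+\<close>), and the
  atoms of sign \<open>s\<close> are numbered \<open>0, 1, \<dots>\<close> below \<open>\<kappa> s \<omega>\<close>. Weights and points are only defined,
  and hence only measurable, on the event that the atom in question exists. The points of both
  signs together are almost surely distinct.\<close>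

definition random_atoms ::
    "'w measure \<Rightarrow> 'a measure \<Rightarrow> (bool \<Rightarrow> 'w \<Rightarrow> enat) \<Rightarrow>
     (bool \<Rightarrow> nat \<Rightarrow> 'w \<Rightarrow> real) \<Rightarrow> (bool \<Rightarrow> nat \<Rightarrow> 'w \<Rightarrow> 'a) \<Rightarrow> bool" where
  "random_atoms P S \<kappa> \<beta> \<sigma> \<longleftrightarrow>
     (\<forall>s. \<kappa> s \<in> P \<rightarrow>\<^sub>M count_space UNIV) \<and>
     (\<forall>s k. \<beta> s k \<in> restrict_space P {\<omega> \<in> space P. enat k < \<kappa> s \<omega>} \<rightarrow>\<^sub>M borel) \<and>
     (\<forall>s k. \<sigma> s k \<in> restrict_space P {\<omega> \<in> space P. enat k < \<kappa> s \<omega>} \<rightarrow>\<^sub>M S) \<and>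
     (AE \<omega> in P. \<forall>s k. enat k < \<kappa> s \<omega> \<longrightarrow> 0 < \<beta> s k \<omega>) \<and>
     (AE \<omega> in P. inj_on (\<lambda>(s, k). \<sigma> s k \<omega>) {(s, k). enat k < \<kappa> s \<omega>})"

definition atomic_decomposition ::
    "'w measure \<Rightarrow> 'a measure \<Rightarrow> 'a set set \<Rightarrow> ('w \<Rightarrow> 'a set \<Rightarrow> real) \<Rightarrow>
     (bool \<Rightarrow> 'w \<Rightarrow> 'a measure) \<Rightarrow> (bool \<Rightarrow> 'w \<Rightarrow> enat) \<Rightarrow>
     (bool \<Rightarrow> nat \<Rightarrow> 'w \<Rightarrow> real) \<Rightarrow> (bool \<Rightarrow> nat \<Rightarrow> 'w \<Rightarrow> 'a) \<Rightarrow> bool" where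
  "atomic_decomposition P S R \<xi> \<alpha> \<kappa> \<beta> \<sigma> \<longleftrightarrow>
     (\<forall>s. diffuse_random_measure P S R (\<alpha> s)) \<and>
     random_atoms P S \<kappa> \<beta> \<sigma> \<and>
     (AE \<omega> in P. \<forall>B\<in>R.
        (\<forall>s. (\<lambda>k. \<beta> s k \<omega>) summable_on {k. enat k < \<kappa> s \<omega> \<and> \<sigma> s k \<omega> \<in> B}) \<and>
        \<xi> \<omega> B = measure (\<alpha> True \<omega>) B - measure (\<alpha> False \<omega>) B
          + (\<Sum>\<^sub>\<infinity>k\<in>{k. enat k < \<kappa> True \<omega> \<and> \<sigma> True k \<omega> \<in> B}. \<beta> True k \<omega>)
          - (\<Sum>\<^sub>\<infinity>k\<in>{k. enat k < \<kappa> False \<omega> \<and> \<sigma> False k \<omega> \<in> B}. \<beta> False k \<omega>))"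

definition signed_point_process ::
    "'w measure \<Rightarrow> 'a measure \<Rightarrow> 'a set set \<Rightarrow> ('w \<Rightarrow> 'a set \<Rightarrow> real) \<Rightarrow> bool" where
  "signed_point_process P S R \<xi> \<longleftrightarrow>
     random_signed_measure P R \<xi> \<and>
     (\<exists>\<alpha> \<kappa> \<beta> \<sigma>. atomic_decomposition P S R \<xi> \<alpha> \<kappa> \<beta> \<sigma> \<and>
        (AE \<omega> in P. \<forall>s. emeasure (\<alpha> s \<omega>) (space S) = 0) \<and>
        (AE \<omega> in P. \<forall>s k. enat k < \<kappa> s \<omega> \<longrightarrow> \<beta> s k \<omega> \<in> \<nat>))"

definition simple_signed_point_process ::
    "'w measure \<Rightarrow> 'a measure \<Rightarrow> 'a set set \<Rightarrow> ('w \<Rightarrow> 'a set \<Rightarrow> real) \<Rightarrow> bool" where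
  "simple_signed_point_process P S R \<xi> \<longleftrightarrow>
     random_signed_measure P R \<xi> \<and>
     (\<exists>\<alpha> \<kappa> \<beta> \<sigma>. atomic_decomposition P S R \<xi> \<alpha> \<kappa> \<beta> \<sigma> \<and>
        (AE \<omega> in P. \<forall>s. emeasure (\<alpha> s \<omega>) (space S) = 0) \<and>
        (AE \<omega> in P. \<forall>s k. enat k < \<kappa> s \<omega> \<longrightarrow> \<beta> s k \<omega> = 1))"

text \<open>As usual for random measures, the Jordan decomposition is taken up to a null event.\<close>

definition jordan_decomposition ::
    "'w measure \<Rightarrow> 'a measure \<Rightarrow> 'a set set \<Rightarrow> ('w \<Rightarrow> 'a set \<Rightarrow> real) \<Rightarrow>
     ('w \<Rightarrow> 'a measure) \<Rightarrow> ('w \<Rightarrow> 'a measure) \<Rightarrow> bool" where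
  "jordan_decomposition P S R \<xi> \<xi>p \<xi>m \<longleftrightarrow>
     random_measure P S R \<xi>p \<and> random_measure P S R \<xi>m \<and>
     (AE \<omega> in P. \<forall>B\<in>R.
        measure (\<xi>p \<omega>) B = (SUP E\<in>{E \<in> sets S. E \<subseteq> B}. \<xi> \<omega> E) \<and>
        measure (\<xi>m \<omega>) B = (SUP E\<in>{E \<in> sets S. E \<subseteq> B}. - \<xi> \<omega> E))"

text \<open>The Poisson law is written out because \<^const>\<open>poisson_pmf\<close> excludes the rate \<open>0\<close>. The
  intensity \<open>\<mu>\<close> is an arbitrary locally finite measure, possibly with atoms.\<close>

definition poisson_point_process ::
    "'w measure \<Rightarrow> 'a measure \<Rightarrow> 'a set set \<Rightarrow> ('w \<Rightarrow> 'a measure) \<Rightarrow> bool" where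
  "poisson_point_process P S R \<zeta> \<longleftrightarrow>
     random_measure P S R \<zeta> \<and>
     (AE \<omega> in P. \<forall>B\<in>R. measure (\<zeta> \<omega>) B \<in> \<nat>) \<and>
     independent_increments P R (\<lambda>\<omega> B. measure (\<zeta> \<omega>) B) \<and>
     (\<exists>\<mu>. sets \<mu> = sets S \<and>
        (\<forall>B\<in>R. emeasure \<mu> B < \<infinity> \<and>
          (\<forall>k::nat. measure P {\<omega> \<in> space P. measure (\<zeta> \<omega>) B = real k} =
             measure \<mu> B ^ k / fact k * exp (- measure \<mu> B))))"

definition skellam_point_process ::
    "'w measure \<Rightarrow> 'a measure \<Rightarrow> 'a set set \<Rightarrow> ('w \<Rightarrow> 'a set \<Rightarrow> real) \<Rightarrow> bool" where
  "skellam_point_process P S R \<xi> \<longleftrightarrow>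
     signed_point_process P S R \<xi> \<and>
     (\<exists>\<xi>p \<xi>m. jordan_decomposition P S R \<xi> \<xi>p \<xi>m \<and>
        poisson_point_process P S R \<xi>p \<and> poisson_point_process P S R \<xi>m \<and>
        prob_space.indep_var P (locally_finite_algebra S R) \<xi>p (locally_finite_algebra S R) \<xi>m)"

text \<open>Without this condition both implications between ``simple with independent increments'' and
  ``Skellam'' fail already on a one-point space: a Bernoulli mass at the point is simple with
  independent increments but not Poisson, and a Poisson mass at the point is Skellam but not
  simple.\<close>

definition no_fixed_atoms ::
    "'w measure \<Rightarrow> 'a measure \<Rightarrow> ('w \<Rightarrow> 'a set \<Rightarrow> real) \<Rightarrow> bool" where
  "no_fixed_atoms P S \<xi> \<longleftrightarrow> (\<forall>x\<in>space S. AE \<omega> in P. \<xi> \<omega> {x} = 0)"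

end

theory Submission
  imports Defs
begin

text \<open>
  Let \<open>\<xi>\<close> be simple with independent increments, and cut a set \<open>B\<close> into dyadic cells. Eventually
  each cell contains at most one atom, so the numbers of positive and negative atoms in \<open>B\<close> are
  limits of the numbers of cells with increment \<open>1\<close> and \<open>-1\<close>. The joint generating function of
  these numbers is a product \<open>\<Prod>j. 1 - a j\<close> over the cells. Its limit is positive, which forces the
  mean numbers of atoms to be finite. The intensities are diffuse since there are no fixed atoms,
  hence \<open>\<Sum>j. (a j)\<^sup>2\<close> tends to \<open>0\<close> and the product tends to the exponential of a sum of
  intensities. This gives the Poisson laws and the factorization of the void probabilities, and
  void events form a generating \<open>\<pi>\<close>-system, whence the independence statements.

  Conversely, the increments of \<open>\<eta>\<close> are differences of independent Poisson increments. A Poisson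
  process with diffuse intensity \<open>\<mu>\<close> has two points in a common cell \<open>C\<close> with probability at most
  \<open>\<Sum>C. (\<mu> C)\<^sup>2\<close>, which tends to \<open>0\<close>, so \<open>\<eta>\<close> is simple.
\<close>

text \<open>Independence is assumed only for the difference of positive and negative counts, so the
  two Jordan parts cannot be treated separately at the outset. A cell with increment 1 may contain
  several atoms of both signs; the argument works with the observable increments and lets refinement
  remove the cancellations. Generating functions with weights in [0,1] replace moments because they
  exist before any integrability is known; finite mean counts are a consequence, and only then are
  the intensities locally finite. The probability that a cell has increment 1 or -1 is not additive
  in the cell, so its squares are controlled through the intensity that dominates it. Weights are
  attached to both signs at once: setting some of them to 0 gives joint void probabilities, and with
  them the independence of the two signs.\<close>

section \<open>Elementary estimates for products and power series\<close>

text \<open>Squeeze exp(-a) between 1 - a and 1/(1 + a) \<le> 1 - a + a^2. The bound is global in a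
  \<ge> 0, so it applies to every cell and not only to those of small probability.\<close>

lemma exp_minus_diff_bound:
  fixes a :: real
  assumes "0 \<le> a"
  shows "\<bar>(1 - a) - exp (- a)\<bar> \<le> a\<^sup>2"
proof -
  have "exp (- a) \<ge> 1 - a"
    using exp_ge_add_one_self[of "- a"] by simp
  moreover have "exp (- a) \<le> 1 - a + a\<^sup>2"
  proof -
    have "exp (- a) = 1 / exp a"
      by (simp add: exp_minus divide_inverse)
    also have "\<dots> \<le> 1 / (1 + a)"
      using assms exp_ge_add_one_self[of a] by (intro divide_left_mono) auto
    also have "\<dots> \<le> 1 - a + a\<^sup>2"
    proof -
      have "(1 - a + a\<^sup>2) * (1 + a) = 1 + a ^ 3"
        by (simp add: algebra_simps power2_eq_square power3_eq_cube)
      then show ?thesis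
        using assms by (simp add: pos_divide_le_eq)
    qed
    finally show ?thesis .
  qed
  ultimately show ?thesis by (simp add: abs_le_iff)
qed

text \<open>Telescoping bounds the difference of two products by the sum of the differences of their
  factors, provided all factors have modulus at most 1. Each difference is quadratic in
  \<open>a n j\<close>, so the sum of squares is the total error.\<close>

lemma prod_one_minus_tendsto_exp:
  fixes a :: "nat \<Rightarrow> 'i \<Rightarrow> real"
  assumes nonneg: "\<And>n j. j \<in> J n \<Longrightarrow> 0 \<le> a n j"
    and le: "\<And>n j. j \<in> J n \<Longrightarrow> \<bar>1 - a n j\<bar> \<le> 1"
    and sum: "(\<lambda>n. \<Sum>j\<in>J n. a n j) \<longlonglongrightarrow> l"
    and squares: "(\<lambda>n. \<Sum>j\<in>J n. (a n j)\<^sup>2) \<longlonglongrightarrow> 0"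
  shows "(\<lambda>n. \<Prod>j\<in>J n. 1 - a n j) \<longlonglongrightarrow> exp (- l)"
proof -
  have bound: "\<bar>(\<Prod>j\<in>J n. 1 - a n j) - exp (- (\<Sum>j\<in>J n. a n j))\<bar> \<le> (\<Sum>j\<in>J n. (a n j)\<^sup>2)" for n
  proof (cases "finite (J n)")
    case True
    have "\<bar>(\<Prod>j\<in>J n. 1 - a n j) - (\<Prod>j\<in>J n. exp (- a n j))\<bar>
        \<le> (\<Sum>j\<in>J n. \<bar>(1 - a n j) - exp (- a n j)\<bar>)"
      using norm_prod_diff[of "J n" "\<lambda>j. 1 - a n j" "\<lambda>j. exp (- a n j)"] nonneg le by simp
    also have "\<dots> \<le> (\<Sum>j\<in>J n. (a n j)\<^sup>2)"
      by (intro sum_mono exp_minus_diff_bound nonneg)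
    finally show ?thesis
      using True by (simp add: exp_sum sum_negf[symmetric])
  \<comment> \<open>For infinite \<open>J n\<close> the product is 1 and both sums are 0 by
    convention, so both sides of the bound are 0.\<close>
  qed auto
  have "(\<lambda>n. (\<Prod>j\<in>J n. 1 - a n j) - exp (- (\<Sum>j\<in>J n. a n j))) \<longlonglongrightarrow> 0"
    by (rule Lim_null_comparison[OF _ squares]) (use bound in auto)
  moreover have "(\<lambda>n. exp (- (\<Sum>j\<in>J n. a n j))) \<longlonglongrightarrow> exp (- l)"
    by (intro tendsto_intros sum)
  ultimately have "(\<lambda>n. ((\<Prod>j\<in>J n. 1 - a n j) - exp (- (\<Sum>j\<in>J n. a n j)))
      + exp (- (\<Sum>j\<in>J n. a n j))) \<longlonglongrightarrow> 0 + exp (- l)"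
    by (rule tendsto_add)
  then show ?thesis by simp
qed

lemma prod_if_if_eq_power:
  fixes u v :: "'b :: comm_monoid_mult"
  assumes "finite J" and "\<And>j. j \<in> J \<Longrightarrow> \<not> (p j \<and> q j)"
  shows "(\<Prod>j\<in>J. if p j then u else if q j then v else 1) = u ^ card {j\<in>J. p j} * v ^ card {j\<in>J. q j}"
proof -
  have "(\<Prod>j\<in>J. if p j then u else if q j then v else 1)
      = (\<Prod>j\<in>J. (if p j then u else 1) * (if q j then v else 1))"
    using assms(2) by (intro prod.cong) auto
  then show ?thesis
    using assms(1) by (simp add: prod.distrib prod.If_cases Int_def)
qed

text \<open>The series is known to vanish only to the right of 0. Convergence at s = 1/2 still gives
  convergence on both sides of 0 for |x| < 1/2, so the sum is continuous at 0 and its value there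
  equals the one-sided limit.\<close>

lemma powser_at_right_zero_coeff_0:
  fixes d :: "nat \<Rightarrow> real"
  assumes d: "\<And>s. 0 < s \<Longrightarrow> s < 1 \<Longrightarrow> (\<lambda>k. d k * s ^ k) sums 0"
  shows "d 0 = 0"
proof -
  define g where "g x = (\<Sum>k. d k * x ^ k)" for x
  have "(\<lambda>k. d k * x ^ k) sums g x" if "\<bar>x\<bar> < 1/2" for x
  proof -
    have "summable (\<lambda>k. d k * (1/2) ^ k)"
      using d[of "1/2"] by (auto simp: sums_iff)
    then have "summable (\<lambda>k. d k * x ^ k)"
      by (rule powser_inside) (use that in auto)
    then show ?thesis unfolding g_def by (rule summable_sums)
  qed
  then have "(g \<longlongrightarrow> d 0) (at 0)"
    by (intro powser_limit_0_strong[where s = "1/2"]) auto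
  then have "(g \<longlongrightarrow> d 0) (at_right 0)"
    by (rule tendsto_mono[rotated]) (simp add: at_le)
  moreover have "(g \<longlongrightarrow> 0) (at_right 0)"
  proof (rule tendsto_eventually)
    have "eventually (\<lambda>x::real. x \<in> {0<..<1}) (at_right 0)"
      by (rule eventually_at_right_real) simp
    then show "eventually (\<lambda>x. g x = 0) (at_right 0)"
      by eventually_elim (use d in \<open>auto simp: g_def sums_iff\<close>)
  qed
  ultimately show ?thesis
    using tendsto_unique[of "at_right (0::real)" g] by (auto simp: trivial_limit_at_right_real)
qed

lemma powser_at_right_zero_coeff:
  fixes d :: "nat \<Rightarrow> real"
  assumes "\<And>s. 0 < s \<Longrightarrow> s < 1 \<Longrightarrow> (\<lambda>k. d k * s ^ k) sums 0"
  shows "d k = 0"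
  using assms
proof (induction k arbitrary: d)
  case 0
  then show ?case by (rule powser_at_right_zero_coeff_0)
next
  case (Suc k)
  have "d 0 = 0"
    using Suc.prems by (rule powser_at_right_zero_coeff_0)
  \<comment> \<open>Since \<open>d 0 = 0\<close>, the series can be divided by s > 0; the shifted
    coefficients again satisfy the hypothesis.\<close>
  have "(\<lambda>k. d (Suc k) * s ^ k) sums 0" if s: "0 < s" "s < 1" for s
  proof -
    have "(\<lambda>k. d (Suc k) * s ^ Suc k) sums 0"
      using Suc.prems[OF s] \<open>d 0 = 0\<close> by (subst sums_Suc_iff) simp
    then have "(\<lambda>k. s * (d (Suc k) * s ^ k)) sums (s * 0)"
      by (simp add: mult_ac)
    then show ?thesis
      by (subst (asm) sums_mult_iff) (use s in auto)
  qed
  then show ?case by (rule Suc.IH)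
qed

text \<open>Serves to read off a law on the naturals from its generating function, evaluated for 0 <
  s < 1 only.\<close>

lemma powser_coeffs_unique_at_right:
  fixes a b :: "nat \<Rightarrow> real"
  assumes "\<And>s. 0 < s \<Longrightarrow> s < 1 \<Longrightarrow> (\<lambda>k. a k * s ^ k) sums f s"
    and "\<And>s. 0 < s \<Longrightarrow> s < 1 \<Longrightarrow> (\<lambda>k. b k * s ^ k) sums f s"
  shows "a k = b k"
proof -
  have "a k - b k = 0"
  proof (rule powser_at_right_zero_coeff)
    fix s :: real assume "0 < s" "s < 1"
    with assms have "(\<lambda>k. a k * s ^ k - b k * s ^ k) sums (f s - f s)"
      by (intro sums_diff)
    then show "(\<lambda>k. (a k - b k) * s ^ k) sums 0"
      by (simp add: algebra_simps)
  qed
  then show ?thesis by simp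
qed

section \<open>Null modifications and differences of independent families\<close>

text \<open>The increments of a signed point process agree with differences of point counts only off
  a null set. Finite intersections of preimages then change by null sets, so the product formulas
  carry over. Measurability of \<open>Y\<close> is assumed separately because the probability space
  need not be complete.\<close>

lemma (in prob_space) indep_vars_AE_cong:
  assumes X: "indep_vars N X I"
    and Y: "\<And>i. i \<in> I \<Longrightarrow> Y i \<in> M \<rightarrow>\<^sub>M N i"
    and eq: "\<And>i. i \<in> I \<Longrightarrow> AE \<omega> in M. X i \<omega> = Y i \<omega>"
  shows "indep_vars N Y I"
  unfolding indep_vars_def2
proof (intro conjI ballI Y indep_setsI)
  show "{Y i -` A \<inter> space M |A. A \<in> sets (N i)} \<subseteq> events" if "i \<in> I" for i
    using Y[OF that] by (auto intro: measurable_sets)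
next
  fix A J
  assume J: "J \<noteq> {}" "J \<subseteq> I" "finite J"
    and "\<forall>j\<in>J. A j \<in> {Y j -` A \<inter> space M |A. A \<in> sets (N j)}"
  then have "\<forall>j\<in>J. \<exists>C. A j = Y j -` C \<inter> space M \<and> C \<in> sets (N j)"
    by blast
  then obtain C where C: "\<And>j. j \<in> J \<Longrightarrow> A j = Y j -` C j \<inter> space M"
      "\<And>j. j \<in> J \<Longrightarrow> C j \<in> sets (N j)"
    by metis
  have meas: "X j -` C j \<inter> space M \<in> events" "Y j -` C j \<inter> space M \<in> events" if "j \<in> J" for j
    using X Y C(2)[OF that] J that by (auto simp: indep_vars_def intro!: measurable_sets)
  have "AE \<omega> in M. \<forall>j\<in>J. X j \<omega> = Y j \<omega>"
    using eq J by (intro AE_finite_allI) auto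
  then have "AE \<omega> in M. \<omega> \<in> (\<Inter>j\<in>J. Y j -` C j \<inter> space M) \<longleftrightarrow> \<omega> \<in> (\<Inter>j\<in>J. X j -` C j \<inter> space M)"
    by eventually_elim auto
  then have "prob (\<Inter>j\<in>J. Y j -` C j \<inter> space M) = prob (\<Inter>j\<in>J. X j -` C j \<inter> space M)"
    using meas J by (intro finite_measure_eq_AE sets.finite_INT) auto
  also have "\<dots> = (\<Prod>j\<in>J. prob (X j -` C j \<inter> space M))"
    using X J C by (intro indep_varsD) auto
  also have "\<dots> = (\<Prod>j\<in>J. prob (Y j -` C j \<inter> space M))"
  proof (intro prod.cong refl finite_measure_eq_AE meas)
    fix j assume "j \<in> J"
    then have "AE \<omega> in M. X j \<omega> = Y j \<omega>" using J eq by blast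
    then show "AE \<omega> in M. \<omega> \<in> X j -` C j \<inter> space M \<longleftrightarrow> \<omega> \<in> Y j -` C j \<inter> space M"
      by eventually_elim auto
  qed auto
  finally show "prob (\<Inter>j\<in>J. A j) = (\<Prod>j\<in>J. prob (A j))"
    using C(1) by (simp cong: INF_cong_simp)
qed

text \<open>The rectangles in \<open>G i\<close> form an intersection-stable generator of the
  \<sigma>-algebra of the pair (\<open>X i\<close>, \<open>Y i\<close>). Hypothesis
  \<open>XY\<close> splits a joint event into its X part and its Y part, and independence within
  each family splits these over the indices. A difference is a function of its pair.\<close>

lemma (in prob_space) indep_vars_diff:
  fixes X Y :: "'i \<Rightarrow> 'a \<Rightarrow> real"
  assumes X: "indep_vars (\<lambda>_. borel) X I" and Y: "indep_vars (\<lambda>_. borel) Y I"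
    and XY: "\<And>J A C. J \<subseteq> I \<Longrightarrow> finite J \<Longrightarrow> (\<And>j. j \<in> J \<Longrightarrow> A j \<in> sets borel \<and> C j \<in> sets borel) \<Longrightarrow>
      prob ({\<omega>\<in>space M. \<forall>j\<in>J. X j \<omega> \<in> A j} \<inter> {\<omega>\<in>space M. \<forall>j\<in>J. Y j \<omega> \<in> C j}) =
      prob {\<omega>\<in>space M. \<forall>j\<in>J. X j \<omega> \<in> A j} * prob {\<omega>\<in>space M. \<forall>j\<in>J. Y j \<omega> \<in> C j}"
  shows "indep_vars (\<lambda>_. borel) (\<lambda>i \<omega>. X i \<omega> - Y i \<omega>) I"
proof -
  define G where "G i = {(X i -` A \<inter> space M) \<inter> (Y i -` C \<inter> space M) |A C. A \<in> sets borel \<and> C \<in> sets borel}" for i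
  have meas: "X i \<in> borel_measurable M" "Y i \<in> borel_measurable M" if "i \<in> I" for i
    using X Y that by (auto simp: indep_vars_def)
  have G_events: "G i \<subseteq> events" if "i \<in> I" for i
    using meas[OF that] by (auto simp: G_def intro!: measurable_sets)
  have "indep_sets G I"
  proof (rule indep_setsI[OF G_events])
    fix D J
    assume J: "J \<noteq> {}" "J \<subseteq> I" "finite J" and "\<forall>j\<in>J. D j \<in> G j"
    then have "\<forall>j\<in>J. \<exists>A C. D j = (X j -` A \<inter> space M) \<inter> (Y j -` C \<inter> space M) \<and> A \<in> sets borel \<and> C \<in> sets borel"
      by (auto simp: G_def)
    then obtain A C where D: "\<And>j. j \<in> J \<Longrightarrow> D j = (X j -` A j \<inter> space M) \<inter> (Y j -` C j \<inter> space M)"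
        and AC: "\<And>j. j \<in> J \<Longrightarrow> A j \<in> sets borel \<and> C j \<in> sets borel"
      by metis
    \<comment> \<open>\<open>XY\<close> for a singleton index set, so that the factors can be
      recombined index by index at the end.\<close>
    have single: "prob (D j) = prob (X j -` A j \<inter> space M) * prob (Y j -` C j \<inter> space M)" if "j \<in> J" for j
    proof -
      have eq: "{\<omega>\<in>space M. \<forall>j\<in>{j}. X j \<omega> \<in> A j} = X j -` A j \<inter> space M"
          "{\<omega>\<in>space M. \<forall>j\<in>{j}. Y j \<omega> \<in> C j} = Y j -` C j \<inter> space M"
        by auto
      show ?thesis
        unfolding D[OF that] eq[symmetric] by (rule XY) (use J AC that in auto)
    qed
    have "(\<Inter>j\<in>J. D j) = {\<omega>\<in>space M. \<forall>j\<in>J. X j \<omega> \<in> A j} \<inter> {\<omega>\<in>space M. \<forall>j\<in>J. Y j \<omega> \<in> C j}"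
    proof -
      have "(\<Inter>j\<in>J. D j) = (\<Inter>j\<in>J. (X j -` A j \<inter> space M) \<inter> (Y j -` C j \<inter> space M))"
        using D by (rule INF_cong[OF refl])
      then show ?thesis using J(1) by auto
    qed
    then have "prob (\<Inter>j\<in>J. D j) = prob {\<omega>\<in>space M. \<forall>j\<in>J. X j \<omega> \<in> A j} * prob {\<omega>\<in>space M. \<forall>j\<in>J. Y j \<omega> \<in> C j}"
      using XY J AC by simp
    also have "{\<omega>\<in>space M. \<forall>j\<in>J. X j \<omega> \<in> A j} = (\<Inter>j\<in>J. X j -` A j \<inter> space M)"
      using J by auto
    also have "{\<omega>\<in>space M. \<forall>j\<in>J. Y j \<omega> \<in> C j} = (\<Inter>j\<in>J. Y j -` C j \<inter> space M)"
      using J by auto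
    also have "prob (\<Inter>j\<in>J. X j -` A j \<inter> space M) = (\<Prod>j\<in>J. prob (X j -` A j \<inter> space M))"
      using J AC by (intro indep_varsD[OF X]) auto
    also have "prob (\<Inter>j\<in>J. Y j -` C j \<inter> space M) = (\<Prod>j\<in>J. prob (Y j -` C j \<inter> space M))"
      using J AC by (intro indep_varsD[OF Y]) auto
    finally show "prob (\<Inter>j\<in>J. D j) = (\<Prod>j\<in>J. prob (D j))"
      by (simp add: single prod.distrib)
  qed
  moreover have "Int_stable (G i)" for i
  proof (rule Int_stableI)
    fix a b assume "a \<in> G i" "b \<in> G i"
    then obtain A C A' C' where "a = (X i -` A \<inter> space M) \<inter> (Y i -` C \<inter> space M)"
        "b = (X i -` A' \<inter> space M) \<inter> (Y i -` C' \<inter> space M)"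
        "A \<in> sets borel" "C \<in> sets borel" "A' \<in> sets borel" "C' \<in> sets borel"
      by (auto simp: G_def)
    then have "a \<inter> b = (X i -` (A \<inter> A') \<inter> space M) \<inter> (Y i -` (C \<inter> C') \<inter> space M)"
        "A \<inter> A' \<in> sets borel" "C \<inter> C' \<in> sets borel"
      by auto
    then show "a \<inter> b \<in> G i"
      unfolding G_def by blast
  qed
  ultimately have "indep_sets (\<lambda>i. sigma_sets (space M) (G i)) I"
    by (rule indep_sets_sigma)
  moreover have "{(\<lambda>\<omega>. X i \<omega> - Y i \<omega>) -` A \<inter> space M |A. A \<in> sets borel} \<subseteq> sigma_sets (space M) (G i)" for i
  proof -
    let ?N = "sigma (space M) (G i)"
    have sub: "G i \<subseteq> Pow (space M)" by (auto simp: G_def)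
    have N: "space ?N = space M" "sets ?N = sigma_sets (space M) (G i)"
      using sub by (auto simp: space_measure_of sets_measure_of)
    have "X i \<in> borel_measurable ?N"
    proof (rule measurableI)
      fix A :: "real set" assume "A \<in> sets borel"
      then have "X i -` A \<inter> space M \<in> G i"
        unfolding G_def by (intro CollectI exI[of _ A] exI[of _ UNIV]) auto
      then show "X i -` A \<inter> space ?N \<in> sets ?N" by (simp add: N)
    qed simp
    moreover have "Y i \<in> borel_measurable ?N"
    proof (rule measurableI)
      fix A :: "real set" assume "A \<in> sets borel"
      then have "Y i -` A \<inter> space M \<in> G i"
        unfolding G_def by (intro CollectI exI[of _ UNIV] exI[of _ A]) auto
      then show "Y i -` A \<inter> space ?N \<in> sets ?N" by (simp add: N)
    qed simp
    ultimately have "(\<lambda>\<omega>. X i \<omega> - Y i \<omega>) \<in> borel_measurable ?N"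
      by simp
    then show ?thesis
      using measurable_sets[of "\<lambda>\<omega>. X i \<omega> - Y i \<omega>" ?N borel] by (auto simp: N)
  qed
  ultimately have "indep_sets (\<lambda>i. {(\<lambda>\<omega>. X i \<omega> - Y i \<omega>) -` A \<inter> space M |A. A \<in> sets borel}) I"
    by (rule indep_sets_mono_sets)
  with meas show ?thesis
    by (auto simp: indep_vars_def2)
qed

section \<open>Dyadic cells\<close>

context localized_borel_space
begin

text \<open>The Borel isomorphism is used as a measurable injection into [0,1]: injectivity lets the
  dyadic cells separate points, and the bounds make finitely many cells suffice at each
  level.\<close>

definition code :: "'a \<Rightarrow> real" where
  "code = (SOME f. f \<in> borel_measurable S \<and> inj_on f (space S) \<and> f ` space S \<subseteq> {0..1})"

lemma code:
  shows code_measurable [measurable]: "code \<in> borel_measurable S"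
    and inj_on_code: "inj_on code (space S)"
    and code_bounds: "code ` space S \<subseteq> {0..1}"
proof -
  obtain A f g where A: "A \<in> sets borel" "A \<subseteq> {0..1::real}"
      and f: "f \<in> S \<rightarrow>\<^sub>M restrict_space borel A" and g: "\<forall>x\<in>space S. g (f x) = x"
    using borel_space unfolding borel_space_def by blast
  have "f \<in> borel_measurable S"
    using f measurable_restrict_space2_iff by blast
  moreover have "inj_on f (space S)"
    using g by (metis inj_onI)
  moreover have "f ` space S \<subseteq> {0..1}"
    using measurable_space[OF f] A(2) by (auto simp: space_restrict_space)
  ultimately have "\<exists>f. f \<in> borel_measurable S \<and> inj_on f (space S) \<and> f ` space S \<subseteq> {0..1::real}"
    by blast
  from someI_ex[OF this] have "code \<in> borel_measurable S \<and> inj_on code (space S) \<and> code ` space S \<subseteq> {0..1}"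
    unfolding code_def .
  then show "code \<in> borel_measurable S" "inj_on code (space S)" "code ` space S \<subseteq> {0..1}"
    by auto
qed

definition idx :: "nat \<Rightarrow> 'a \<Rightarrow> nat" where
  "idx n x = nat \<lfloor>2 ^ n * code x\<rfloor>"

definition cell :: "nat \<Rightarrow> nat \<Rightarrow> 'a set" where
  "cell n j = {x \<in> space S. idx n x = j}"

lemma idx_measurable [measurable]: "idx n \<in> S \<rightarrow>\<^sub>M count_space UNIV"
proof -
  have "(\<lambda>x. \<lfloor>2 ^ n * code x\<rfloor>) \<in> S \<rightarrow>\<^sub>M count_space UNIV"
    by (rule measurable_compose[OF _ measurable_real_floor]) simp
  then have "(\<lambda>x. nat \<lfloor>2 ^ n * code x\<rfloor>) \<in> S \<rightarrow>\<^sub>M count_space UNIV"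
    by (rule measurable_compose) simp
  then show ?thesis by (simp add: idx_def[abs_def])
qed

lemma cell_sets [measurable]: "cell n j \<in> sets S"
proof -
  have "cell n j = idx n -` {j} \<inter> space S" by (auto simp: cell_def)
  then show ?thesis by (simp add: measurable_sets[OF idx_measurable])
qed

text \<open>The value 2^n is attained exactly where \<open>code\<close> is 1, which is why sums over
  cells run over \<open>{..2 ^ n}\<close> and not over \<open>{..<2 ^ n}\<close>.\<close>

lemma idx_le:
  assumes "x \<in> space S"
  shows "idx n x \<le> 2 ^ n"
proof -
  have "2 ^ n * code x \<le> 2 ^ n * 1"
    using code_bounds assms by (intro mult_left_mono) auto
  then have "\<lfloor>2 ^ n * code x\<rfloor> \<le> \<lfloor>2 ^ n :: real\<rfloor>"
    by (intro floor_mono) simp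
  also have "\<dots> = 2 ^ n" by simp
  finally show ?thesis
    by (simp add: idx_def nat_le_iff)
qed

text \<open>Reals with equal floors differ by less than 1, so the indices differ as soon as 2^n
  |code x - code y| > 1.\<close>

lemma eventually_idx_neq:
  assumes xy: "x \<in> space S" "y \<in> space S" "x \<noteq> y"
  shows "eventually (\<lambda>n. idx n x \<noteq> idx n y) sequentially"
proof -
  have pos: "0 < \<bar>code x - code y\<bar>"
    using inj_on_code xy by (auto dest: inj_onD)
  have "(\<lambda>n. inverse ((2::real) ^ n)) \<longlonglongrightarrow> 0"
    by (rule LIMSEQ_inverse_realpow_zero) simp
  then have "eventually (\<lambda>n. inverse (2 ^ n) < \<bar>code x - code y\<bar>) sequentially"
    using pos by (rule order_tendstoD)
  then show ?thesis
  proof eventually_elim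
    case (elim n)
    then have "1 < 2 ^ n * \<bar>code x - code y\<bar>"
      by (simp add: field_simps)
    then have *: "1 < \<bar>2 ^ n * code x - 2 ^ n * code y\<bar>"
      by (simp add: abs_mult right_diff_distrib[symmetric])
    show ?case
    proof
      assume "idx n x = idx n y"
      \<comment> \<open>\<open>nat\<close> identifies all negative floors with 0; nonnegativity
        makes it injective here.\<close>
      moreover have "0 \<le> 2 ^ n * code x" "0 \<le> 2 ^ n * code y"
        using code_bounds xy by auto
      ultimately have "\<lfloor>2 ^ n * code x\<rfloor> = \<lfloor>2 ^ n * code y\<rfloor>"
        by (simp add: idx_def eq_nat_nat_iff)
      then show False
        using * by linarith
    qed
  qed
qed

lemma eventually_inj_on_idx:
  assumes "finite F" "F \<subseteq> space S"
  shows "eventually (\<lambda>n. inj_on (idx n) F) sequentially"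
proof -
  have "eventually (\<lambda>n. \<forall>x\<in>F. \<forall>y\<in>F. x \<noteq> y \<longrightarrow> idx n x \<noteq> idx n y) sequentially"
    using assms eventually_idx_neq
    by (intro eventually_ball_finite ballI) (auto simp: subset_iff)
  then show ?thesis
    by eventually_elim (auto simp: inj_on_def)
qed

lemma R_sets: "B \<in> R \<Longrightarrow> B \<in> sets S"
  using ring_subset by auto

lemma R_subset_closed:
  assumes "B \<in> R" "C \<in> sets S" "C \<subseteq> B"
  shows "C \<in> R"
  using Int_closed[OF assms(1,2)] assms(3) by (simp add: Int_absorb1)

lemma cell_in_R: "B \<in> R \<Longrightarrow> B \<inter> cell n j \<in> R"
  by (rule Int_closed) auto

lemma localizing:
  obtains A where "range A \<subseteq> R" "incseq A" "(\<Union>n::nat. A n) = space S"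
proof -
  obtain A where A: "range A \<subseteq> R \<and> incseq A \<and> (\<Union>n::nat. A n) = space S \<and>
      R = (\<Union>n. {C \<inter> A n |C. C \<in> sets S})"
    using localizing_sequence by (rule exE)
  show thesis
    using A by (intro that[of A]) blast+
qed

lemma singleton_sets:
  assumes "x \<in> space S"
  shows "{x} \<in> sets S"
proof -
  have "code -` {code x} \<inter> space S \<in> sets S"
    by (rule measurable_sets[OF code_measurable]) simp
  also have "code -` {code x} \<inter> space S = {x}"
    using assms inj_on_code by (auto dest: inj_onD)
  finally show ?thesis .
qed

lemma singleton_in_R:
  assumes "x \<in> space S"
  shows "{x} \<in> R"
proof -
  obtain A where A: "range A \<subseteq> R" "(\<Union>n::nat. A n) = space S"
    by (rule localizing)
  then obtain n where n: "x \<in> A n" using assms by blast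
  have "A n \<in> R" using A(1) by blast
  then show ?thesis
    using singleton_sets[OF assms] by (rule R_subset_closed) (simp add: n)
qed

lemma countable_sets:
  assumes "countable C" "C \<subseteq> space S"
  shows "C \<in> sets S"
  by (rule sets.countable[OF _ assms(1)]) (use assms(2) singleton_sets in blast)

section \<open>Squared cell masses of a diffuse measure\<close>

text \<open>The sum is the M-integral of \<open>h n\<close>, which maps x to the mass of the cell
  around x. The indicators of these cells converge to that of {x}, so \<open>h n x\<close> tends to
  M{x} = 0. Dominated convergence is used twice: for the inner mass and for the integral.\<close>

lemma sum_cell_squares_tendsto_0_finite:
  assumes "finite_measure M" and sets_M [measurable_cong]: "sets M = sets S"
    and diffuse: "\<And>x. x \<in> space S \<Longrightarrow> measure M {x} = 0"
  shows "(\<lambda>n. \<Sum>j\<le>2 ^ n. (measure M (cell n j))\<^sup>2) \<longlonglongrightarrow> 0"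
proof -
  interpret M: finite_measure M by fact
  have sp: "space M = space S" using sets_eq_imp_space_eq[OF sets_M] .
  define h where "h n x = measure M (cell n (idx n x))" for n x
  have h_meas [measurable]: "h n \<in> borel_measurable M" for n
    unfolding h_def measurable_cong_sets[OF sets_M refl]
    by (rule measurable_compose[OF idx_measurable]) simp
  have h_lim: "(\<lambda>n. h n x) \<longlonglongrightarrow> 0" if x: "x \<in> space S" for x
  proof -
    have "(\<lambda>n. \<integral>y. indicator (cell n (idx n x)) y \<partial>M) \<longlonglongrightarrow> (\<integral>y. indicat_real {x} y \<partial>M)"
    proof (rule integral_dominated_convergence[where w = "\<lambda>_. 1"])
      show "AE y in M. (\<lambda>n. indicator (cell n (idx n x)) y) \<longlonglongrightarrow> (indicator {x} y :: real)"
      proof (rule AE_I2)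
        fix y assume "y \<in> space M"
        then have y: "y \<in> space S" by (simp add: sp)
        show "(\<lambda>n. indicator (cell n (idx n x)) y) \<longlonglongrightarrow> (indicator {x} y :: real)"
        proof (cases "x = y")
          case True
          then show ?thesis using x by (simp add: cell_def)
        next
          case False
          from eventually_idx_neq[OF x y this]
          have "eventually (\<lambda>n. indicator (cell n (idx n x)) y = (0::real)) sequentially"
            by eventually_elim (auto simp: cell_def)
          then show ?thesis using False by (simp add: tendsto_eventually)
        qed
      qed
    qed (use singleton_sets[OF x] in \<open>auto simp: indicator_def sets_M\<close>)
    then show ?thesis
      using diffuse[OF x] sets.sets_into_space[OF cell_sets] x by (simp add: h_def sp Int_absorb2)
  qed
  have "(\<lambda>n. \<integral>x. h n x \<partial>M) \<longlonglongrightarrow> (\<integral>x. 0 \<partial>M)"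
  proof (rule integral_dominated_convergence[where w = "\<lambda>_. measure M (space M)"])
    show "AE x in M. (\<lambda>n. h n x) \<longlonglongrightarrow> 0"
      using h_lim by (intro AE_I2) (simp add: sp)
    show "AE x in M. norm (h n x) \<le> measure M (space M)" for n
      by (auto simp: h_def M.bounded_measure)
  qed auto
  moreover have "(\<integral>x. h n x \<partial>M) = (\<Sum>j\<le>2 ^ n. (measure M (cell n j))\<^sup>2)" for n
  proof -
    have "(\<integral>x. h n x \<partial>M) = (\<integral>x. (\<Sum>j\<le>2 ^ n. indicator (cell n j) x * measure M (cell n j)) \<partial>M)"
    proof (rule Bochner_Integration.integral_cong[OF refl])
      fix x assume "x \<in> space M"
      then have "(\<Sum>j\<le>2 ^ n. indicator (cell n j) x * measure M (cell n j))
          = (\<Sum>j\<in>{..2 ^ n}. if j = idx n x then measure M (cell n j) else 0)"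
        by (intro sum.cong) (auto simp: cell_def sp indicator_def)
      also have "\<dots> = h n x"
        using \<open>x \<in> space M\<close> idx_le by (simp add: sp h_def)
      finally show "h n x = (\<Sum>j\<le>2 ^ n. indicator (cell n j) x * measure M (cell n j))" ..
    qed
    also have "\<dots> = (\<Sum>j\<le>2 ^ n. \<integral>x. indicator (cell n j) x * measure M (cell n j) \<partial>M)"
      by (rule Bochner_Integration.integral_sum) (simp add: sets_M M.emeasure_finite less_top[symmetric])
    also have "\<dots> = (\<Sum>j\<le>2 ^ n. (measure M (cell n j))\<^sup>2)"
      using sets.sets_into_space[OF cell_sets] by (simp add: power2_eq_square sp Int_absorb2)
    finally show ?thesis .
  qed
  ultimately show ?thesis by simp
qed

text \<open>The restriction of M to B, realized as a density, is finite, and its cell masses are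
  those of M on the traces of the cells on B.\<close>

lemma sum_cell_squares_tendsto_0:
  assumes sets_M: "sets M = sets S" and B: "B \<in> R" and fin: "emeasure M B < \<infinity>"
    and diffuse: "\<And>x. x \<in> space S \<Longrightarrow> emeasure M {x} = 0"
  shows "(\<lambda>n. \<Sum>j\<le>2 ^ n. (measure M (B \<inter> cell n j))\<^sup>2) \<longlonglongrightarrow> 0"
proof -
  let ?N = "density M (indicator B)"
  have BM: "B \<in> sets M" using R_sets[OF B] sets_M by simp
  have em: "emeasure ?N C = emeasure M (B \<inter> C)" if "C \<in> sets S" for C
    using that BM sets_M by (simp add: emeasure_restricted)
  have "(\<lambda>n. \<Sum>j\<le>2 ^ n. (measure ?N (cell n j))\<^sup>2) \<longlonglongrightarrow> 0"
  proof (rule sum_cell_squares_tendsto_0_finite)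
    show "finite_measure ?N"
      using em[of "space S"] fin R_sets[OF B] sets_eq_imp_space_eq[OF sets_M]
      by (intro finite_measureI) (simp add: Int_absorb2 sets.sets_into_space)
    show "measure ?N {x} = 0" if "x \<in> space S" for x
    proof -
      have "emeasure M (B \<inter> {x}) \<le> emeasure M {x}"
        using singleton_sets[OF that] sets_M by (intro emeasure_mono) auto
      then show ?thesis
        using em[OF singleton_sets[OF that]] diffuse[OF that] by (simp add: measure_def)
    qed
  qed (simp add: sets_M)
  then show ?thesis
    using em by (simp add: measure_def)
qed

section \<open>Evaluations on the space of locally finite measures\<close>

lemma R_nonempty: "R \<noteq> {}"
  using empty_sets by auto

lemma space_locally_finite_algebra:
  "space (locally_finite_algebra S R) = {M. sets M = sets S \<and> (\<forall>C\<in>R. emeasure M C < \<infinity>)}"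
  unfolding locally_finite_algebra_def using R_nonempty by (simp add: space_Sup_eq_UN)

lemma measurable_emeasure_locally_finite:
  assumes "B \<in> R"
  shows "(\<lambda>M. emeasure M B) \<in> borel_measurable (locally_finite_algebra S R)"
  unfolding locally_finite_algebra_def
  by (rule measurable_SUP1[OF assms]) (simp_all add: measurable_vimage_algebra1)

lemma measurable_locally_finite_algebraI:
  assumes "\<And>\<omega>. \<omega> \<in> space N \<Longrightarrow> sets (f \<omega>) = sets S"
    and "\<And>\<omega> C. \<omega> \<in> space N \<Longrightarrow> C \<in> R \<Longrightarrow> emeasure (f \<omega>) C < \<infinity>"
    and "\<And>C. C \<in> R \<Longrightarrow> (\<lambda>\<omega>. emeasure (f \<omega>) C) \<in> borel_measurable N"
  shows "f \<in> N \<rightarrow>\<^sub>M locally_finite_algebra S R"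
  unfolding locally_finite_algebra_def
proof (rule measurable_SUP2[OF R_nonempty])
  fix B assume "B \<in> R"
  then show "f \<in> N \<rightarrow>\<^sub>M vimage_algebra {M. sets M = sets S \<and> (\<forall>C\<in>R. emeasure M C < \<infinity>)} (\<lambda>M. emeasure M B) borel"
    using assms by (intro measurable_vimage_algebra2) blast+
qed simp

end

section \<open>Generating functions of signed point configurations\<close>

locale localized_prob_space = prob_space P + localized_borel_space S R
  for P :: "'w measure" and S :: "'a measure" and R :: "'a set set"
begin

text \<open>The definition of independent increments numbers its sets by an initial segment of the
  naturals. A bijection transports it to any finite index set, in particular to pairs of a set and a
  cell; boundedness of \<phi> makes the factors integrable.\<close>

lemma independent_increments_expectation_prod:
  fixes B :: "'i \<Rightarrow> 'a set" and \<phi> :: "'i \<Rightarrow> real \<Rightarrow> real"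
  assumes \<xi>: "independent_increments P R \<xi>"
    and I: "finite I" "\<And>i. i \<in> I \<Longrightarrow> B i \<in> R" "disjoint_family_on B I"
    and \<phi>: "\<And>i. i \<in> I \<Longrightarrow> \<phi> i \<in> borel_measurable borel" "\<And>i x. i \<in> I \<Longrightarrow> \<bar>\<phi> i x\<bar> \<le> 1"
  shows "expectation (\<lambda>\<omega>. \<Prod>i\<in>I. \<phi> i (\<xi> \<omega> (B i))) = (\<Prod>i\<in>I. expectation (\<lambda>\<omega>. \<phi> i (\<xi> \<omega> (B i))))"
proof -
  obtain h where h: "bij_betw h {..<card I} I"
    using ex_bij_betw_nat_finite[OF I(1)] by (auto simp: atLeast0LessThan)
  have hI: "h k \<in> I" if "k < card I" for k
    using h that by (auto simp: bij_betw_def)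
  have "disjoint_family_on (\<lambda>k. B (h k)) {..<card I}"
    unfolding disjoint_family_on_def
  proof (intro ballI impI)
    fix k l assume kl: "k \<in> {..<card I}" "l \<in> {..<card I}" "k \<noteq> l"
    then have "h k \<noteq> h l"
      using h by (auto simp: bij_betw_def dest: inj_onD)
    then show "B (h k) \<inter> B (h l) = {}"
      using I(3) hI kl unfolding disjoint_family_on_def by blast
  qed
  then have ind: "indep_vars (\<lambda>_. borel) (\<lambda>k \<omega>. \<xi> \<omega> (B (h k))) {..<card I}"
    using \<xi>[unfolded independent_increments_def, rule_format, of "card I" "\<lambda>k. B (h k)"] I(2) hI by auto
  have ind': "indep_vars (\<lambda>_. borel) (\<lambda>k \<omega>. \<phi> (h k) (\<xi> \<omega> (B (h k)))) {..<card I}"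
    by (rule indep_vars_compose2[OF ind]) (use \<phi>(1) hI in blast)
  have meas: "(\<lambda>\<omega>. \<phi> (h k) (\<xi> \<omega> (B (h k)))) \<in> borel_measurable P" if "k < card I" for k
    using ind' that by (auto simp: indep_vars_def)
  have "expectation (\<lambda>\<omega>. \<Prod>k<card I. \<phi> (h k) (\<xi> \<omega> (B (h k))))
      = (\<Prod>k<card I. expectation (\<lambda>\<omega>. \<phi> (h k) (\<xi> \<omega> (B (h k)))))"
  proof (rule indep_vars_lebesgue_integral[OF _ ind'])
    show "integrable P (\<lambda>\<omega>. \<phi> (h k) (\<xi> \<omega> (B (h k))))" if "k \<in> {..<card I}" for k
      using that hI by (intro integrable_const_bound[of _ 1] meas AE_I2) (simp_all add: \<phi>(2))
  qed simp
  then show ?thesis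
    by (simp add: prod.reindex_bij_betw[OF h, of "\<lambda>i. \<phi> i (\<xi> _ (B i))"]
        prod.reindex_bij_betw[OF h, of "\<lambda>i. expectation (\<lambda>\<omega>. \<phi> i (\<xi> \<omega> (B i)))"])
qed

end

text \<open>\<open>T True \<omega>\<close> and \<open>T False \<omega>\<close> are the positions of
  the positive and negative unit atoms. Finiteness and disjointness are required for every \<omega>;
  the exceptional null set is removed before the locale is interpreted, so pathwise counting needs
  no almost sure qualifiers.\<close>

locale signed_points = localized_prob_space P S R
  for P :: "'w measure" and S :: "'a measure" and R :: "'a set set" +
  fixes T :: "bool \<Rightarrow> 'w \<Rightarrow> 'a set"
  assumes T_subset: "T s \<omega> \<subseteq> space S"
    and finite_T: "B \<in> R \<Longrightarrow> finite (T s \<omega> \<inter> B)"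
    and T_disjoint: "T True \<omega> \<inter> T False \<omega> = {}"
    and count_measurable: "B \<in> R \<Longrightarrow> (\<lambda>\<omega>. real (card (T s \<omega> \<inter> B))) \<in> borel_measurable P"
    and increments: "independent_increments P R
      (\<lambda>\<omega> B. real (card (T True \<omega> \<inter> B)) - real (card (T False \<omega> \<inter> B)))"
    and T_no_fixed: "x \<in> space S \<Longrightarrow> AE \<omega> in P. x \<notin> T s \<omega>"
begin

definition num :: "bool \<Rightarrow> 'a set \<Rightarrow> 'w \<Rightarrow> nat" where
  "num s B \<omega> = card (T s \<omega> \<inter> B)"

definition net :: "'a set \<Rightarrow> 'w \<Rightarrow> real" where
  "net B \<omega> = real (num True B \<omega>) - real (num False B \<omega>)"

definition sign :: "bool \<Rightarrow> real" where
  "sign s = (if s then 1 else - 1)"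

text \<open>Cells are selected by net increment and not by number of atoms, because only the net
  increments are known to be independent. For coarse cells this may miscount through
  cancellation.\<close>

definition cells_of :: "bool \<Rightarrow> nat \<Rightarrow> 'a set \<Rightarrow> 'w \<Rightarrow> nat set" where
  "cells_of s n B \<omega> = {j\<in>{..2 ^ n}. net (B \<inter> cell n j) \<omega> = sign s}"

lemma num_measurable:
  assumes "B \<in> R"
  shows "(\<lambda>\<omega>. real (num s B \<omega>)) \<in> borel_measurable P"
  using count_measurable[OF assms] by (simp add: num_def)

lemma net_measurable:
  assumes "B \<in> R"
  shows "net B \<in> borel_measurable P"
  unfolding net_def using num_measurable[OF assms] by simp

lemma net_increments: "independent_increments P R (\<lambda>\<omega> B. net B \<omega>)"
  using increments by (simp add: net_def num_def)

lemma net_eq_sign_imp_num_pos: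
  assumes "net B \<omega> = sign s"
  shows "num s B \<omega> > 0"
  using assms by (cases s) (auto simp: net_def sign_def intro!: Nat.gr0I)

text \<open>An increment \<open>sign s\<close> requires an atom of sign s in the cell. The resulting
  bound of the cell count by \<open>num s B\<close> is uniform in n and provides the dominating
  function once the mean is finite.\<close>

lemma cells_of_subset: "cells_of s n B \<omega> \<subseteq> idx n ` (T s \<omega> \<inter> B)"
proof
  fix j assume "j \<in> cells_of s n B \<omega>"
  then have "num s (B \<inter> cell n j) \<omega> > 0"
    by (auto simp: cells_of_def intro: net_eq_sign_imp_num_pos)
  then have "T s \<omega> \<inter> (B \<inter> cell n j) \<noteq> {}"
    by (auto simp: num_def)
  then show "j \<in> idx n ` (T s \<omega> \<inter> B)"
    by (auto simp: cell_def)
qed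

lemma card_cells_of_le:
  assumes "B \<in> R"
  shows "card (cells_of s n B \<omega>) \<le> num s B \<omega>"
  unfolding num_def
  using surj_card_le[OF finite_T[OF assms] cells_of_subset] .

text \<open>As soon as \<open>idx n\<close> separates the atoms in B, each atom is alone in its cell
  and the increment there is its own sign.\<close>

lemma eventually_card_cells_of:
  assumes B: "B \<in> R"
  shows "eventually (\<lambda>n. card (cells_of s n B \<omega>) = num s B \<omega>) sequentially"
proof -
  \<comment> \<open>The two signs have to be separated jointly: an atom of opposite sign in the same
    cell would cancel the increment.\<close>
  let ?F = "(T True \<omega> \<union> T False \<omega>) \<inter> B"
  have "finite ?F"
    using finite_T[OF B] by (simp add: Int_Un_distrib2)
  moreover have "?F \<subseteq> space S"
    using T_subset by blast
  ultimately have "eventually (\<lambda>n. inj_on (idx n) ?F) sequentially"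
    by (rule eventually_inj_on_idx)
  then show ?thesis
  proof eventually_elim
    case (elim n)
    have T_F: "T s \<omega> \<inter> B \<subseteq> ?F" for s by (cases s) auto
    have "idx n ` (T s \<omega> \<inter> B) \<subseteq> cells_of s n B \<omega>"
    proof (rule image_subsetI)
      fix x assume x: "x \<in> T s \<omega> \<inter> B"
      then have "x \<in> space S" using T_subset by blast
      have only_x: "y = x" if "y \<in> T s' \<omega> \<inter> (B \<inter> cell n (idx n x))" for y s'
        using that x T_F[of s'] T_F[of s] by (intro inj_onD[OF elim]) (auto simp: cell_def)
      have "T s \<omega> \<inter> (B \<inter> cell n (idx n x)) = {x}"
        using only_x[of _ s] x \<open>x \<in> space S\<close> by (auto simp: cell_def)
      moreover have "x \<notin> T (\<not> s) \<omega>"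
        using x T_disjoint by (cases s) auto
      then have "T (\<not> s) \<omega> \<inter> (B \<inter> cell n (idx n x)) = {}"
        using only_x[of _ "\<not> s"] by auto
      ultimately have "net (B \<inter> cell n (idx n x)) \<omega> = sign s"
        by (cases s) (simp_all add: net_def num_def sign_def)
      then show "idx n x \<in> cells_of s n B \<omega>"
        using idx_le[OF \<open>x \<in> space S\<close>] by (simp add: cells_of_def)
    qed
    then have "cells_of s n B \<omega> = idx n ` (T s \<omega> \<inter> B)"
      using cells_of_subset by blast
    then show ?case
      using card_image[OF inj_on_subset[OF elim T_F]] by (simp add: num_def)
  qed
qed

section \<open>Weighted cell products and their limits\<close>

definition hit :: "bool \<Rightarrow> 'a set \<Rightarrow> real" where
  "hit s B = prob {\<omega>\<in>space P. net B \<omega> = sign s}"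

text \<open>Increments other than 1 and -1 get weight 1, even if the cell holds several atoms. Hence
  the product over the cells is a monomial in the two cell counts, and each expected factor is 1
  minus a combination of the two hit probabilities.\<close>

definition weight :: "(bool \<Rightarrow> real) \<Rightarrow> real \<Rightarrow> real" where
  "weight w x = (if x = sign True then w True else if x = sign False then w False else 1)"

lemma hit_event:
  assumes "B \<in> R"
  shows "{\<omega>\<in>space P. net B \<omega> = sign s} \<in> events"
  using net_measurable[OF assms] by measurable

lemma hit_bounds: "0 \<le> hit s B" "hit s B \<le> 1"
  by (simp_all add: hit_def)

lemma weight_measurable: "weight w \<in> borel_measurable borel"
  unfolding weight_def by measurable

lemma weight_bound:
  assumes "\<And>s. 0 \<le> w s" "\<And>s. w s \<le> 1"
  shows "\<bar>weight w x\<bar> \<le> 1"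
  using assms by (auto simp: weight_def)

lemma expectation_weight:
  assumes "B \<in> R"
  shows "expectation (\<lambda>\<omega>. weight w (net B \<omega>)) = 1 - ((1 - w True) * hit True B + (1 - w False) * hit False B)"
proof -
  let ?E = "\<lambda>s. {\<omega>\<in>space P. net B \<omega> = sign s}"
  have "expectation (\<lambda>\<omega>. weight w (net B \<omega>))
      = expectation (\<lambda>\<omega>. 1 - ((1 - w True) * indicator (?E True) \<omega> + (1 - w False) * indicator (?E False) \<omega>))"
    by (intro Bochner_Integration.integral_cong refl) (auto simp: weight_def sign_def indicator_def)
  also have "\<dots> = 1 - ((1 - w True) * prob (?E True) + (1 - w False) * prob (?E False))"
    using hit_event[OF assms, of True] hit_event[OF assms, of False]
    by (simp add: prob_space less_top[symmetric] Int_absorb2)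
  finally show ?thesis by (simp add: hit_def)
qed

lemma prod_weight_eq:
  "(\<Prod>j\<le>2 ^ n. weight w (net (B \<inter> cell n j) \<omega>))
    = w True ^ card (cells_of True n B \<omega>) * w False ^ card (cells_of False n B \<omega>)"
  unfolding weight_def cells_of_def by (rule prod_if_if_eq_power) (auto simp: sign_def)

text \<open>Pairs of a set and a cell give disjoint members of R, so the expectation factorizes at
  each level, and bounded convergence passes to the true counts. A separate weight for every set and
  sign makes the limit a joint generating function.\<close>

lemma pgf_limit:
  fixes B :: "'i \<Rightarrow> 'a set" and w :: "'i \<Rightarrow> bool \<Rightarrow> real"
  assumes I: "finite I" "\<And>i. i \<in> I \<Longrightarrow> B i \<in> R" "disjoint_family_on B I"
    and w: "\<And>i s. 0 \<le> w i s" "\<And>i s. w i s \<le> 1"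
  shows "(\<lambda>n. \<Prod>(i, j)\<in>I \<times> {..2 ^ n}. 1 - ((1 - w i True) * hit True (B i \<inter> cell n j)
        + (1 - w i False) * hit False (B i \<inter> cell n j)))
      \<longlonglongrightarrow> expectation (\<lambda>\<omega>. \<Prod>i\<in>I. w i True ^ num True (B i) \<omega> * w i False ^ num False (B i) \<omega>)"
proof -
  let ?Z = "\<lambda>n \<omega>. \<Prod>i\<in>I. w i True ^ card (cells_of True n (B i) \<omega>) * w i False ^ card (cells_of False n (B i) \<omega>)"
  let ?W = "\<lambda>n \<omega>. \<Prod>x\<in>I \<times> {..2 ^ n}. weight (w (fst x)) (net (B (fst x) \<inter> cell n (snd x)) \<omega>)"
  have ZW: "?Z n \<omega> = ?W n \<omega>" for n \<omega>
    by (simp add: prod_weight_eq[symmetric] prod.cartesian_product split_beta)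
  have "expectation (?W n) = (\<Prod>x\<in>I \<times> {..2 ^ n}. expectation (\<lambda>\<omega>. weight (w (fst x)) (net (B (fst x) \<inter> cell n (snd x)) \<omega>)))" for n
  proof (rule independent_increments_expectation_prod[OF net_increments])
    show "B (fst x) \<inter> cell n (snd x) \<in> R" if "x \<in> I \<times> {..2 ^ n}" for x :: "'i \<times> nat"
      using that I(2) by (auto intro: cell_in_R)
    show "disjoint_family_on (\<lambda>x. B (fst x) \<inter> cell n (snd x)) (I \<times> {..2 ^ n})"
      unfolding disjoint_family_on_def
    proof (intro ballI impI)
      fix x y :: "'i \<times> nat" assume xy: "x \<in> I \<times> {..2 ^ n}" "y \<in> I \<times> {..2 ^ n}" "x \<noteq> y"
      show "(B (fst x) \<inter> cell n (snd x)) \<inter> (B (fst y) \<inter> cell n (snd y)) = {}"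
      proof (cases "fst x = fst y")
        case True
        then have "snd x \<noteq> snd y" using xy by (auto simp: prod_eq_iff)
        then show ?thesis by (auto simp: cell_def)
      next
        case False
        then have "B (fst x) \<inter> B (fst y) = {}"
          using xy by (intro disjoint_family_onD[OF I(3)]) (auto simp: mem_Times_iff)
        then show ?thesis by blast
      qed
    qed
  qed (use I(1) w in \<open>auto simp: weight_measurable intro!: weight_bound\<close>)
  then have EZ: "expectation (?Z n) = (\<Prod>(i, j)\<in>I \<times> {..2 ^ n}. 1 - ((1 - w i True) * hit True (B i \<inter> cell n j)
        + (1 - w i False) * hit False (B i \<inter> cell n j)))" for n
    using I(2) by (auto simp: ZW expectation_weight cell_in_R split_beta intro!: prod.cong)
  have "(\<lambda>n. expectation (?Z n)) \<longlonglongrightarrow> expectation (\<lambda>\<omega>. \<Prod>i\<in>I. w i True ^ num True (B i) \<omega> * w i False ^ num False (B i) \<omega>)"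
  proof (rule integral_dominated_convergence[where w = "\<lambda>_. 1"])
    have W_meas: "?W n \<in> borel_measurable P" for n
    proof (rule borel_measurable_prod)
      fix x :: "'i \<times> nat" assume "x \<in> I \<times> {..2 ^ n}"
      then have "B (fst x) \<inter> cell n (snd x) \<in> R"
        using I(2) by (auto intro: cell_in_R)
      from measurable_compose[OF net_measurable[OF this] weight_measurable]
      show "(\<lambda>\<omega>. weight (w (fst x)) (net (B (fst x) \<inter> cell n (snd x)) \<omega>)) \<in> borel_measurable P" .
    qed
    show Z_meas: "?Z n \<in> borel_measurable P" for n
      using W_meas[of n] by (simp add: ZW)
    \<comment> \<open>For each \<omega> the sequence is eventually constant, so exponents converge
      trivially and weights equal to 0 are covered.\<close>
    have lim: "(\<lambda>n. ?Z n \<omega>) \<longlonglongrightarrow> (\<Prod>i\<in>I. w i True ^ num True (B i) \<omega> * w i False ^ num False (B i) \<omega>)" for \<omega>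
    proof (rule tendsto_eventually)
      have "eventually (\<lambda>n. \<forall>i\<in>I. \<forall>s. card (cells_of s n (B i) \<omega>) = num s (B i) \<omega>) sequentially"
        using I eventually_card_cells_of
        by (intro eventually_ball_finite ballI eventually_all_finite) auto
      then show "eventually (\<lambda>n. ?Z n \<omega> = (\<Prod>i\<in>I. w i True ^ num True (B i) \<omega> * w i False ^ num False (B i) \<omega>)) sequentially"
        by eventually_elim (auto intro!: prod.cong)
    qed
    then show "AE \<omega> in P. (\<lambda>n. ?Z n \<omega>) \<longlonglongrightarrow> (\<Prod>i\<in>I. w i True ^ num True (B i) \<omega> * w i False ^ num False (B i) \<omega>)"
      by simp
    show "(\<lambda>\<omega>. \<Prod>i\<in>I. w i True ^ num True (B i) \<omega> * w i False ^ num False (B i) \<omega>) \<in> borel_measurable P"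
      by (rule borel_measurable_LIMSEQ_real[OF lim Z_meas])
    show "AE \<omega> in P. norm (?Z n \<omega>) \<le> 1" for n
    proof (rule AE_I2)
      fix \<omega>
      have "0 \<le> ?Z n \<omega>" "?Z n \<omega> \<le> 1"
        using w by (auto intro!: prod_nonneg prod_le_1 mult_le_one power_le_one)
      then show "norm (?Z n \<omega>) \<le> 1" by simp
    qed
  qed simp
  then show ?thesis by (simp add: EZ)
qed

lemma pgf_limit_single:
  assumes B: "B \<in> R" and w: "\<And>s. 0 \<le> w s" "\<And>s. w s \<le> 1"
  shows "(\<lambda>n. \<Prod>j\<le>2 ^ n. 1 - ((1 - w True) * hit True (B \<inter> cell n j) + (1 - w False) * hit False (B \<inter> cell n j)))
      \<longlonglongrightarrow> expectation (\<lambda>\<omega>. w True ^ num True B \<omega> * w False ^ num False B \<omega>)"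
proof -
  have "(\<lambda>n. \<Prod>(i, j)\<in>{()} \<times> {..2 ^ n}. 1 - ((1 - w True) * hit True (B \<inter> cell n j) + (1 - w False) * hit False (B \<inter> cell n j)))
      \<longlonglongrightarrow> expectation (\<lambda>\<omega>. \<Prod>i\<in>{()}. w True ^ num True B \<omega> * w False ^ num False B \<omega>)"
    by (rule pgf_limit) (use B w in \<open>auto simp: disjoint_family_on_def\<close>)
  then show ?thesis
    by (simp add: prod.cartesian_product[symmetric])
qed

lemma card_cells_of_eq_sum:
  assumes "\<omega> \<in> space P"
  shows "real (card (cells_of s n B \<omega>)) = (\<Sum>j\<le>2 ^ n. indicator {\<omega>\<in>space P. net (B \<inter> cell n j) \<omega> = sign s} \<omega>)"
proof -
  have "(\<Sum>j\<le>2 ^ n. indicator {\<omega>\<in>space P. net (B \<inter> cell n j) \<omega> = sign s} \<omega> :: real)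
      = (\<Sum>j\<in>{..2 ^ n}. if net (B \<inter> cell n j) \<omega> = sign s then 1 else 0)"
    using assms by (intro sum.cong) (auto simp: indicator_def)
  also have "\<dots> = real (card (cells_of s n B \<omega>))"
    by (simp add: sum.If_cases cells_of_def Int_def)
  finally show ?thesis ..
qed

lemma card_cells_of_measurable:
  assumes "B \<in> R"
  shows "(\<lambda>\<omega>. real (card (cells_of s n B \<omega>))) \<in> borel_measurable P"
proof -
  have "(\<lambda>\<omega>. \<Sum>j\<le>2 ^ n. indicator {\<omega>\<in>space P. net (B \<inter> cell n j) \<omega> = sign s} \<omega> :: real) \<in> borel_measurable P"
    by (intro borel_measurable_sum borel_measurable_indicator hit_event cell_in_R assms)
  then show ?thesis
    by (subst measurable_cong[OF card_cells_of_eq_sum]) auto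
qed

lemma expectation_cells_of:
  assumes "B \<in> R"
  shows "integrable P (\<lambda>\<omega>. real (card (cells_of s n B \<omega>)))"
    and "expectation (\<lambda>\<omega>. real (card (cells_of s n B \<omega>))) = (\<Sum>j\<le>2 ^ n. hit s (B \<inter> cell n j))"
proof -
  have "card (cells_of s n B \<omega>) \<le> card {..(2::nat) ^ n}" for \<omega>
    by (rule card_mono) (auto simp: cells_of_def)
  then have "real (card (cells_of s n B \<omega>)) \<le> real (2 ^ n + 1)" for \<omega>
    by (metis add.commute card_atMost of_nat_le_iff plus_1_eq_Suc)
  then show "integrable P (\<lambda>\<omega>. real (card (cells_of s n B \<omega>)))"
    by (intro integrable_const_bound[of _ "real (2 ^ n + 1)"] card_cells_of_measurable[OF assms] AE_I2) simp
  have "expectation (\<lambda>\<omega>. real (card (cells_of s n B \<omega>)))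
      = expectation (\<lambda>\<omega>. \<Sum>j\<le>2 ^ n. indicator {\<omega>\<in>space P. net (B \<inter> cell n j) \<omega> = sign s} \<omega>)"
    by (intro Bochner_Integration.integral_cong refl card_cells_of_eq_sum)
  also have "\<dots> = (\<Sum>j\<le>2 ^ n. expectation (indicator {\<omega>\<in>space P. net (B \<inter> cell n j) \<omega> = sign s}))"
    using hit_event[OF cell_in_R[OF assms]]
    by (intro Bochner_Integration.integral_sum) (simp add: less_top[symmetric])
  also have "\<dots> = (\<Sum>j\<le>2 ^ n. hit s (B \<inter> cell n j))"
    by (intro sum.cong refl) (simp add: hit_def Int_absorb2)
  finally show "expectation (\<lambda>\<omega>. real (card (cells_of s n B \<omega>))) = (\<Sum>j\<le>2 ^ n. hit s (B \<inter> cell n j))" .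
qed

text \<open>The expected number of unit cells is bounded because the product of the factors
  \<open>1 - hit / 2\<close> converges to the expectation of \<open>(1/2) ^ num\<close>, which is positive.\<close>

lemma sum_hit_bounded:
  assumes B: "B \<in> R"
  obtains K where "eventually (\<lambda>n. (\<Sum>j\<le>2 ^ n. hit s (B \<inter> cell n j)) \<le> K) sequentially"
proof -
  \<comment> \<open>Weight 0 would turn \<open>e\<close> into a void probability, whose positivity
    is not yet known; with 1/2 the integrand is strictly positive everywhere.\<close>
  define w :: "bool \<Rightarrow> real" where "w x = (if x = s then 1 / 2 else 1)" for x
  define e where "e = expectation (\<lambda>\<omega>. w True ^ num True B \<omega> * w False ^ num False B \<omega>)"
  have w: "0 < w x" "w x \<le> 1" for x by (auto simp: w_def)
  have lim: "(\<lambda>n. \<Prod>j\<le>2 ^ n. 1 - hit s (B \<inter> cell n j) / 2) \<longlonglongrightarrow> e"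
  proof -
    have eq: "1 - ((1 - w True) * hit True C + (1 - w False) * hit False C) = 1 - hit s C / 2" for C
      by (cases s) (auto simp: w_def)
    have "(\<lambda>n. \<Prod>j\<le>2 ^ n. 1 - ((1 - w True) * hit True (B \<inter> cell n j) + (1 - w False) * hit False (B \<inter> cell n j))) \<longlonglongrightarrow> e"
      unfolding e_def using B w by (intro pgf_limit_single) (simp_all add: less_imp_le)
    then show ?thesis
      unfolding eq .
  qed
  have "e > 0"
    unfolding e_def
  proof (rule expectation_greater)
    have m: "(\<lambda>\<omega>. w x ^ num x B \<omega>) \<in> borel_measurable P" for x
    proof -
      have "(\<lambda>\<omega>. w x powr real (num x B \<omega>)) \<in> borel_measurable P"
        using num_measurable[OF B] by simp
      then show ?thesis using w by (simp add: powr_realpow)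
    qed
    show "integrable P (\<lambda>\<omega>. w True ^ num True B \<omega> * w False ^ num False B \<omega>)"
      using w by (intro integrable_const_bound[of _ 1] AE_I2 borel_measurable_times m)
        (auto simp: abs_mult less_imp_le intro!: mult_le_one power_le_one)
  qed (use w in auto)
  then have "eventually (\<lambda>n. e / 2 < (\<Prod>j\<le>2 ^ n. 1 - hit s (B \<inter> cell n j) / 2)) sequentially"
    by (intro order_tendstoD(1)[OF lim]) simp
  \<comment> \<open>With h the hit probabilities, 1 - h/2 \<le> exp(-h/2) converts the lower bound
    e/2 for the product into e/2 < exp(-(sum of h)/2); solving for the sum gives the
    constant.\<close>
  then have "eventually (\<lambda>n. (\<Sum>j\<le>2 ^ n. hit s (B \<inter> cell n j)) \<le> - 2 * ln (e / 2)) sequentially"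
  proof eventually_elim
    case (elim n)
    have "(\<Prod>j\<le>2 ^ n. 1 - hit s (B \<inter> cell n j) / 2) \<le> (\<Prod>j\<le>2 ^ n. exp (- (hit s (B \<inter> cell n j) / 2)))"
    proof (rule prod_mono)
      fix j
      show "0 \<le> 1 - hit s (B \<inter> cell n j) / 2 \<and> 1 - hit s (B \<inter> cell n j) / 2 \<le> exp (- (hit s (B \<inter> cell n j) / 2))"
        using hit_bounds[of s "B \<inter> cell n j"] exp_ge_add_one_self[of "- (hit s (B \<inter> cell n j) / 2)"] by simp
    qed
    also have "\<dots> = exp (- ((\<Sum>j\<le>2 ^ n. hit s (B \<inter> cell n j)) / 2))"
      by (simp add: exp_sum[symmetric] sum_negf sum_divide_distrib)
    finally have "e / 2 < exp (- ((\<Sum>j\<le>2 ^ n. hit s (B \<inter> cell n j)) / 2))"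
      using elim by simp
    then have "ln (e / 2) < - ((\<Sum>j\<le>2 ^ n. hit s (B \<inter> cell n j)) / 2)"
      using \<open>e > 0\<close> by (metis exp_gt_zero half_gt_zero ln_exp ln_less_cancel_iff)
    then show ?case by simp
  qed
  then show thesis by (rule that)
qed

text \<open>Fatou's lemma is the tool because cancellation inside cells prevents monotonicity in n,
  and a dominating integrable function is what is still being sought.\<close>

lemma integrable_num:
  assumes B: "B \<in> R"
  shows "integrable P (\<lambda>\<omega>. real (num s B \<omega>))"
proof -
  obtain K where K: "eventually (\<lambda>n. (\<Sum>j\<le>2 ^ n. hit s (B \<inter> cell n j)) \<le> K) sequentially"
    using sum_hit_bounded[OF B] by blast
  let ?u = "\<lambda>n \<omega>. ennreal (real (card (cells_of s n B \<omega>)))"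
  have "(\<integral>\<^sup>+\<omega>. ennreal (real (num s B \<omega>)) \<partial>P) = (\<integral>\<^sup>+\<omega>. liminf (\<lambda>n. ?u n \<omega>) \<partial>P)"
  proof (intro nn_integral_cong)
    fix \<omega>
    have "(\<lambda>n. ?u n \<omega>) \<longlonglongrightarrow> ennreal (real (num s B \<omega>))"
      using eventually_card_cells_of[OF B, of s \<omega>]
      by (intro tendsto_eventually) (auto elim: eventually_mono)
    then show "ennreal (real (num s B \<omega>)) = liminf (\<lambda>n. ?u n \<omega>)"
      by (intro lim_imp_Liminf[symmetric]) auto
  qed
  also have "\<dots> \<le> liminf (\<lambda>n. \<integral>\<^sup>+\<omega>. ?u n \<omega> \<partial>P)"
    using card_cells_of_measurable[OF B] by (intro nn_integral_liminf) simp
  also have "\<dots> \<le> ennreal K"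
  proof (rule Liminf_le)
    have "(\<integral>\<^sup>+\<omega>. ?u n \<omega> \<partial>P) = ennreal (\<Sum>j\<le>2 ^ n. hit s (B \<inter> cell n j))" for n
      using expectation_cells_of[OF B, of s n] by (simp add: nn_integral_eq_integral)
    then show "eventually (\<lambda>n. (\<integral>\<^sup>+\<omega>. ?u n \<omega> \<partial>P) \<le> ennreal K) sequentially"
      using K by (auto elim!: eventually_mono intro: ennreal_leI)
  qed simp
  also have "ennreal K < \<infinity>"
    by simp
  finally have "(\<integral>\<^sup>+\<omega>. ennreal (real (num s B \<omega>)) \<partial>P) < \<infinity>" .
  then show ?thesis
    using num_measurable[OF B] by (intro integrableI_bounded) auto
qed

text \<open>Now that \<open>num s B\<close> is integrable, it dominates the cell counts, and the
  bound from Fatou's lemma improves to convergence of the means.\<close>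

lemma sum_hit_tendsto:
  assumes B: "B \<in> R"
  shows "(\<lambda>n. \<Sum>j\<le>2 ^ n. hit s (B \<inter> cell n j)) \<longlonglongrightarrow> expectation (\<lambda>\<omega>. real (num s B \<omega>))"
proof -
  have "(\<lambda>n. expectation (\<lambda>\<omega>. real (card (cells_of s n B \<omega>)))) \<longlonglongrightarrow> expectation (\<lambda>\<omega>. real (num s B \<omega>))"
  proof (rule integral_dominated_convergence[where w = "\<lambda>\<omega>. real (num s B \<omega>)"])
    show "AE \<omega> in P. (\<lambda>n. real (card (cells_of s n B \<omega>))) \<longlonglongrightarrow> real (num s B \<omega>)"
    proof (rule AE_I2)
      fix \<omega>
      show "(\<lambda>n. real (card (cells_of s n B \<omega>))) \<longlonglongrightarrow> real (num s B \<omega>)"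
        using eventually_card_cells_of[OF B, of s \<omega>]
        by (intro tendsto_eventually) (auto elim: eventually_mono)
    qed
  qed (use integrable_num[OF B] num_measurable[OF B] card_cells_of_measurable[OF B] card_cells_of_le[OF B] in auto)
  then show ?thesis
    by (simp add: expectation_cells_of[OF B])
qed

section \<open>Counting measures and their intensities\<close>

text \<open>Counting measure on the atoms, pushed forward along the identity so that it carries the
  \<sigma>-algebra of S in place of a power set.\<close>

definition points :: "bool \<Rightarrow> 'w \<Rightarrow> 'a measure" where
  "points s \<omega> = distr (count_space (T s \<omega>)) S (\<lambda>x. x)"

lemma sets_points [simp, measurable_cong]: "sets (points s \<omega>) = sets S"
  by (simp add: points_def)

lemma emeasure_points:
  assumes "C \<in> sets S"
  shows "emeasure (points s \<omega>) C = emeasure (count_space (T s \<omega>)) (T s \<omega> \<inter> C)"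
proof -
  have "(\<lambda>x. x) \<in> count_space (T s \<omega>) \<rightarrow>\<^sub>M S"
    using T_subset by auto
  from emeasure_distr[OF this assms] show ?thesis
    by (simp add: points_def Int_commute)
qed

lemma emeasure_points_R:
  assumes "B \<in> R"
  shows "emeasure (points s \<omega>) B = ennreal (real (num s B \<omega>))"
  using finite_T[OF assms] R_sets[OF assms]
  by (simp add: emeasure_points num_def ennreal_of_nat_eq_real_of_nat)

lemma measure_points_R:
  assumes "B \<in> R"
  shows "measure (points s \<omega>) B = real (num s B \<omega>)"
  by (simp add: measure_def emeasure_points_R[OF assms])

text \<open>Counts are measurable by assumption on R. Exhaustion by the localizing sequence extends
  this to all measurable sets, as required for the mean measure to be countably additive on all of
  S, where it may be infinite.\<close>

lemma emeasure_points_measurable: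
  assumes C: "C \<in> sets S"
  shows "(\<lambda>\<omega>. emeasure (points s \<omega>) C) \<in> borel_measurable P"
proof -
  obtain A where A: "range A \<subseteq> R" "incseq A" "(\<Union>n::nat. A n) = space S"
    by (rule localizing)
  have CA: "C \<inter> A n \<in> R" for n
    using A(1) C Int_closed[of "A n" C] by (auto simp: Int_commute)
  have eq: "emeasure (points s \<omega>) C = (SUP n. ennreal (real (num s (C \<inter> A n) \<omega>)))" for \<omega>
  proof -
    have "(\<Union>n. C \<inter> A n) = C"
      using A(3) sets.sets_into_space[OF C] by blast
    moreover have "(SUP n. emeasure (points s \<omega>) (C \<inter> A n)) = emeasure (points s \<omega>) (\<Union>n. C \<inter> A n)"
      using A(2) R_sets[OF CA] by (intro SUP_emeasure_incseq) (auto simp: incseq_def)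
    ultimately show ?thesis
      by (simp add: emeasure_points_R[OF CA])
  qed
  show ?thesis
    unfolding eq using num_measurable[OF CA] by (intro borel_measurable_SUP) auto
qed

definition intensity :: "bool \<Rightarrow> 'a measure" where
  "intensity s = measure_of (space S) (sets S) (\<lambda>C. \<integral>\<^sup>+\<omega>. emeasure (points s \<omega>) C \<partial>P)"

lemma sets_intensity [simp, measurable_cong]: "sets (intensity s) = sets S"
  by (simp add: intensity_def sets.sigma_sets_eq)

lemma emeasure_intensity:
  assumes "C \<in> sets S"
  shows "emeasure (intensity s) C = (\<integral>\<^sup>+\<omega>. emeasure (points s \<omega>) C \<partial>P)"
proof (rule emeasure_measure_of[OF intensity_def])
  show "countably_additive (sets (intensity s)) (\<lambda>C. \<integral>\<^sup>+\<omega>. emeasure (points s \<omega>) C \<partial>P)"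
  proof (rule countably_additiveI)
    fix A :: "nat \<Rightarrow> 'a set"
    assume A: "range A \<subseteq> sets (intensity s)" "disjoint_family A"
    then have A': "A i \<in> sets S" for i by auto
    have "(\<Sum>i. \<integral>\<^sup>+\<omega>. emeasure (points s \<omega>) (A i) \<partial>P) = (\<integral>\<^sup>+\<omega>. (\<Sum>i. emeasure (points s \<omega>) (A i)) \<partial>P)"
      by (rule nn_integral_suminf[symmetric]) (rule emeasure_points_measurable[OF A'])
    also have "\<dots> = (\<integral>\<^sup>+\<omega>. emeasure (points s \<omega>) (\<Union>i. A i) \<partial>P)"
      using A A' by (intro nn_integral_cong suminf_emeasure) auto
    finally show "(\<Sum>i. \<integral>\<^sup>+\<omega>. emeasure (points s \<omega>) (A i) \<partial>P) = (\<integral>\<^sup>+\<omega>. emeasure (points s \<omega>) (\<Union>i. A i) \<partial>P)" .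
  qed
qed (use assms sets.space_closed in \<open>auto simp: positive_def\<close>)

lemma emeasure_intensity_R:
  assumes B: "B \<in> R"
  shows "emeasure (intensity s) B = ennreal (expectation (\<lambda>\<omega>. real (num s B \<omega>)))"
  using integrable_num[OF B]
  by (simp add: emeasure_intensity R_sets[OF B] emeasure_points_R[OF B] nn_integral_eq_integral)

lemma measure_intensity_R:
  assumes B: "B \<in> R"
  shows "measure (intensity s) B = expectation (\<lambda>\<omega>. real (num s B \<omega>))"
  by (simp add: measure_def emeasure_intensity_R[OF B])

lemma intensity_diffuse:
  assumes x: "x \<in> space S"
  shows "emeasure (intensity s) {x} = 0"
proof -
  have "AE \<omega> in P. emeasure (points s \<omega>) {x} = 0"
    using T_no_fixed[OF x, of s]
    by eventually_elim (simp add: emeasure_points singleton_sets[OF x])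
  then have "(\<integral>\<^sup>+\<omega>. emeasure (points s \<omega>) {x} \<partial>P) = (\<integral>\<^sup>+\<omega>. 0 \<partial>P)"
    by (rule nn_integral_cong_AE)
  then show ?thesis
    by (simp add: emeasure_intensity singleton_sets[OF x])
qed

text \<open>The event forces an atom of sign s, so its indicator is at most the count. Squared hit
  probabilities are thereby bounded by squared cell masses of a diffuse measure.\<close>

lemma hit_le_intensity:
  assumes B: "B \<in> R"
  shows "hit s B \<le> measure (intensity s) B"
proof -
  let ?E = "{\<omega>\<in>space P. net B \<omega> = sign s}"
  have "hit s B = expectation (indicator ?E)"
    by (simp add: hit_def Int_absorb2)
  also have "\<dots> \<le> expectation (\<lambda>\<omega>. real (num s B \<omega>))"
  proof (rule integral_mono)
    show "indicator ?E \<omega> \<le> real (num s B \<omega>)" for \<omega>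
      using net_eq_sign_imp_num_pos[of B \<omega> s] by (auto simp: indicator_def)
  qed (use hit_event[OF B] integrable_num[OF B] in \<open>auto simp: less_top[symmetric]\<close>)
  finally show ?thesis by (simp add: measure_intensity_R[OF B])
qed

lemma sum_hit_squares_tendsto_0:
  assumes B: "B \<in> R"
  shows "(\<lambda>n. \<Sum>j\<le>2 ^ n. (hit s (B \<inter> cell n j))\<^sup>2) \<longlonglongrightarrow> 0"
proof (rule tendsto_sandwich[of "\<lambda>_. 0"])
  show "(\<lambda>n. \<Sum>j\<le>2 ^ n. (measure (intensity s) (B \<inter> cell n j))\<^sup>2) \<longlonglongrightarrow> 0"
    using B intensity_diffuse by (intro sum_cell_squares_tendsto_0) (auto simp: emeasure_intensity_R)
  show "eventually (\<lambda>n. (\<Sum>j\<le>2 ^ n. (hit s (B \<inter> cell n j))\<^sup>2) \<le>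
      (\<Sum>j\<le>2 ^ n. (measure (intensity s) (B \<inter> cell n j))\<^sup>2)) sequentially"
    using B by (intro always_eventually allI sum_mono power_mono hit_le_intensity cell_in_R hit_bounds)
qed (simp_all add: sum_nonneg)

text \<open>Two evaluations of one limit: \<open>pgf_limit\<close> identifies the limit of the cell
  products as the expectation, and \<open>prod_one_minus_tendsto_exp\<close> as an exponential,
  since hit probabilities sum to the intensities in the limit while their squares vanish.\<close>

lemma joint_pgf:
  fixes B :: "'i \<Rightarrow> 'a set" and w :: "'i \<Rightarrow> bool \<Rightarrow> real"
  assumes I: "finite I" "\<And>i. i \<in> I \<Longrightarrow> B i \<in> R" "disjoint_family_on B I"
    and w: "\<And>i s. 0 \<le> w i s" "\<And>i s. w i s \<le> 1"
  shows "expectation (\<lambda>\<omega>. \<Prod>i\<in>I. w i True ^ num True (B i) \<omega> * w i False ^ num False (B i) \<omega>)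
    = exp (- (\<Sum>i\<in>I. (1 - w i True) * measure (intensity True) (B i) + (1 - w i False) * measure (intensity False) (B i)))"
proof -
  define h where "h n i s j = (1 - w i s) * hit s (B i \<inter> cell n j)" for n i s j
  define a where "a n x = h n (fst x) True (snd x) + h n (fst x) False (snd x)" for n x
  have h_nonneg: "0 \<le> h n i s j" for n i s j
    using w by (simp add: h_def hit_bounds)
  have h_le: "h n i s j \<le> hit s (B i \<inter> cell n j)" for n i s j
    using w hit_bounds by (simp add: h_def mult_left_le_one_le)
  have "(\<lambda>n. \<Prod>x\<in>I \<times> {..2 ^ n}. 1 - a n x) \<longlonglongrightarrow>
      exp (- (\<Sum>i\<in>I. (1 - w i True) * measure (intensity True) (B i) + (1 - w i False) * measure (intensity False) (B i)))"
  proof (rule prod_one_minus_tendsto_exp)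
    show "0 \<le> a n x" for n x
      using h_nonneg by (simp add: a_def)
    show "\<bar>1 - a n x\<bar> \<le> 1" if "x \<in> I \<times> {..2 ^ n}" for n x
    proof -
      have "B (fst x) \<inter> cell n (snd x) \<in> R"
        using that I(2) by (auto intro: cell_in_R)
      from expectation_weight[OF this, of "w (fst x)"]
      have "1 - a n x = expectation (\<lambda>\<omega>. weight (w (fst x)) (net (B (fst x) \<inter> cell n (snd x)) \<omega>))"
        by (simp add: a_def h_def)
      also have "\<bar>\<dots>\<bar> \<le> expectation (\<lambda>\<omega>. \<bar>weight (w (fst x)) (net (B (fst x) \<inter> cell n (snd x)) \<omega>)\<bar>)"
        by (rule integral_abs_bound)
      also have "\<dots> \<le> expectation (\<lambda>\<omega>. 1)"
        using w by (intro integral_mono_AE' AE_I2 weight_bound) auto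
      finally show ?thesis by (simp add: prob_space)
    qed
    have "(\<lambda>n. \<Sum>i\<in>I. (1 - w i True) * (\<Sum>j\<le>2 ^ n. hit True (B i \<inter> cell n j))
        + (1 - w i False) * (\<Sum>j\<le>2 ^ n. hit False (B i \<inter> cell n j))) \<longlonglongrightarrow>
      (\<Sum>i\<in>I. (1 - w i True) * measure (intensity True) (B i) + (1 - w i False) * measure (intensity False) (B i))"
      by (intro tendsto_intros) (simp_all add: I(2) measure_intensity_R sum_hit_tendsto)
    then show "(\<lambda>n. \<Sum>x\<in>I \<times> {..2 ^ n}. a n x) \<longlonglongrightarrow>
      (\<Sum>i\<in>I. (1 - w i True) * measure (intensity True) (B i) + (1 - w i False) * measure (intensity False) (B i))"
      by (simp add: a_def h_def sum_distrib_left sum.distrib sum.cartesian_product split_beta)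
    show "(\<lambda>n. \<Sum>x\<in>I \<times> {..2 ^ n}. (a n x)\<^sup>2) \<longlonglongrightarrow> 0"
    proof (rule tendsto_sandwich[of "\<lambda>_. 0"])
      have "(\<lambda>n. \<Sum>i\<in>I. 2 * (\<Sum>j\<le>2 ^ n. (hit True (B i \<inter> cell n j))\<^sup>2)
          + 2 * (\<Sum>j\<le>2 ^ n. (hit False (B i \<inter> cell n j))\<^sup>2)) \<longlonglongrightarrow> (\<Sum>i\<in>I. 2 * 0 + 2 * 0)"
        by (intro tendsto_intros sum_hit_squares_tendsto_0 I(2))
      then show "(\<lambda>n. \<Sum>x\<in>I \<times> {..2 ^ n}. 2 * (hit True (B (fst x) \<inter> cell n (snd x)))\<^sup>2
          + 2 * (hit False (B (fst x) \<inter> cell n (snd x)))\<^sup>2) \<longlonglongrightarrow> 0"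
        by (simp add: sum_distrib_left sum.distrib sum.cartesian_product split_beta)
      show "eventually (\<lambda>n. (\<Sum>x\<in>I \<times> {..2 ^ n}. (a n x)\<^sup>2) \<le>
          (\<Sum>x\<in>I \<times> {..2 ^ n}. 2 * (hit True (B (fst x) \<inter> cell n (snd x)))\<^sup>2
          + 2 * (hit False (B (fst x) \<inter> cell n (snd x)))\<^sup>2)) sequentially"
      proof (intro always_eventually allI sum_mono)
        fix n and x :: "'i \<times> nat"
        let ?p = "hit True (B (fst x) \<inter> cell n (snd x))" and ?q = "hit False (B (fst x) \<inter> cell n (snd x))"
        have "a n x \<le> ?p + ?q"
          using h_le by (simp add: a_def add_mono)
        then have "(a n x)\<^sup>2 \<le> (?p + ?q)\<^sup>2"
          using h_nonneg by (intro power_mono) (simp_all add: a_def)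
        also have "\<dots> \<le> 2 * ?p\<^sup>2 + 2 * ?q\<^sup>2"
          using sum_squares_bound[of ?p ?q] by (simp add: power2_sum)
        finally show "(a n x)\<^sup>2 \<le> 2 * ?p\<^sup>2 + 2 * ?q\<^sup>2" .
      qed
    qed (simp_all add: sum_nonneg)
  qed
  then show ?thesis
    using pgf_limit[of I B w, OF I w] by (simp add: a_def h_def split_beta LIMSEQ_unique)
qed

end

section \<open>The Poisson property\<close>

context signed_points
begin

lemma num_event:
  assumes "B \<in> R"
  shows "{\<omega>\<in>space P. num s B \<omega> = k} \<in> events"
proof -
  have "{\<omega>\<in>space P. real (num s B \<omega>) = real k} \<in> events"
    using num_measurable[OF assms] by measurable
  then show ?thesis by simp
qed

lemma num_pgf:
  assumes B: "B \<in> R" and t: "0 \<le> t" "t \<le> 1"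
  shows "expectation (\<lambda>\<omega>. t ^ num s B \<omega>) = exp (- ((1 - t) * measure (intensity s) B))"
proof -
  define w :: "unit \<Rightarrow> bool \<Rightarrow> real" where "w i x = (if x = s then t else 1)" for i x
  have "expectation (\<lambda>\<omega>. \<Prod>i\<in>{()}. w i True ^ num True B \<omega> * w i False ^ num False B \<omega>)
    = exp (- (\<Sum>i\<in>{()}. (1 - w i True) * measure (intensity True) B + (1 - w i False) * measure (intensity False) B))"
    by (rule joint_pgf) (use B t in \<open>auto simp: w_def disjoint_family_on_def\<close>)
  then show ?thesis
    by (cases s) (simp_all add: w_def)
qed

text \<open>Expanding the mean of t^num over the values of \<open>num\<close> gives a power series
  in t whose coefficients are the point probabilities; comparison with the exponential series for
  \<open>num_pgf\<close> identifies them. Since 0^0 = 1, intensity 0 is included.\<close>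

lemma num_poisson:
  assumes B: "B \<in> R"
  shows "prob {\<omega>\<in>space P. num s B \<omega> = k} =
    measure (intensity s) B ^ k / fact k * exp (- measure (intensity s) B)"
proof (rule powser_coeffs_unique_at_right)
  let ?m = "measure (intensity s) B"
  let ?E = "\<lambda>k. {\<omega>\<in>space P. num s B \<omega> = k}"
  fix t :: real
  assume t: "0 < t" "t < 1"
  have abs_t: "\<bar>t\<bar> = t" using t by simp
  have expect: "expectation (\<lambda>\<omega>. t ^ k * indicator (?E k) \<omega>) = prob (?E k) * t ^ k" for k
    by (simp add: Int_absorb2 mult.commute)
  have "(\<lambda>k. expectation (\<lambda>\<omega>. t ^ k * indicator (?E k) \<omega>)) sums expectation (\<lambda>\<omega>. \<Sum>k. t ^ k * indicator (?E k) \<omega>)"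
  proof (rule sums_integral)
    show "integrable P (\<lambda>\<omega>. t ^ k * indicator (?E k) \<omega>)" for k
      using num_event[OF B, of s k] by (simp add: less_top[symmetric])
    show "AE \<omega> in P. summable (\<lambda>k. norm (t ^ k * indicator (?E k) \<omega>))"
    proof (rule AE_I2)
      fix \<omega>
      show "summable (\<lambda>k. norm (t ^ k * indicator (?E k) \<omega>))"
        by (rule summable_finite[of "{num s B \<omega>}"]) (auto simp: indicator_def)
    qed
    have "norm (prob (?E k) * t ^ k) \<le> t ^ k" for k
      using t by (simp add: abs_mult mult_left_le_one_le)
    then have "summable (\<lambda>k. prob (?E k) * t ^ k)"
      using t by (intro summable_comparison_test'[OF summable_geometric[of t]]) auto
    then show "summable (\<lambda>k. expectation (\<lambda>\<omega>. norm (t ^ k * indicator (?E k) \<omega>)))"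
      using expect t by (simp add: abs_mult abs_t mult.commute)
  qed
  moreover have "(\<Sum>k. t ^ k * indicator (?E k) \<omega>) = t ^ num s B \<omega>" if "\<omega> \<in> space P" for \<omega>
    using that by (subst suminf_finite[of "{num s B \<omega>}"]) (auto simp: indicator_def)
  then have "expectation (\<lambda>\<omega>. \<Sum>k. t ^ k * indicator (?E k) \<omega>) = expectation (\<lambda>\<omega>. t ^ num s B \<omega>)"
    by (intro Bochner_Integration.integral_cong refl)
  ultimately show "(\<lambda>k. prob (?E k) * t ^ k) sums exp (- ((1 - t) * ?m))"
    using num_pgf[OF B, of t s] t unfolding expect by simp
next
  let ?m = "measure (intensity s) B"
  fix t :: real
  have "(\<lambda>k. exp (- ?m) * ((?m * t) ^ k /\<^sub>R fact k)) sums (exp (- ?m) * exp (?m * t))"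
    by (intro sums_mult exp_converges)
  then show "(\<lambda>k. ?m ^ k / fact k * exp (- ?m) * t ^ k) sums exp (- ((1 - t) * ?m))"
    by (simp add: power_mult_distrib field_simps flip: exp_add)
qed

lemma num_split:
  assumes "B \<in> R"
  shows "num s B \<omega> = num s (B \<inter> C) \<omega> + num s (B - C) \<omega>"
proof -
  have eq: "T s \<omega> \<inter> B = (T s \<omega> \<inter> (B \<inter> C)) \<union> (T s \<omega> \<inter> (B - C))" by blast
  have "finite (T s \<omega> \<inter> (B \<inter> C))" "finite (T s \<omega> \<inter> (B - C))"
    by (rule finite_subset[OF _ finite_T[OF assms]]; blast)+
  then show ?thesis
    unfolding num_def by (subst eq, intro card_Un_disjoint) auto
qed

lemma intensity_split:
  assumes "B \<in> R" "C \<in> sets S"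
  shows "measure (intensity s) B = measure (intensity s) (B \<inter> C) + measure (intensity s) (B - C)"
proof -
  have BC: "B \<inter> C \<in> R" "B - C \<in> R"
    using assms R_sets by (auto intro: R_subset_closed[of B])
  show ?thesis
    unfolding measure_intensity_R[OF assms(1)] measure_intensity_R[OF BC(1)] measure_intensity_R[OF BC(2)]
    by (simp add: num_split[OF assms(1), of _ _ C] integrable_num BC)
qed

text \<open>B and C may overlap, while \<open>joint_pgf\<close> is about disjoint sets; hence the
  pieces B - C, B \<inter> C and C - B. Positive atoms get weight 0 in the first two and negative
  atoms in the last two, so the monomial becomes the indicator of the void event.\<close>

lemma prob_void:
  assumes B: "B \<in> R" and C: "C \<in> R"
  shows "prob {\<omega>\<in>space P. num True B \<omega> = 0 \<and> num False C \<omega> = 0}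
    = exp (- measure (intensity True) B) * exp (- measure (intensity False) C)"
proof -
  define D :: "nat \<Rightarrow> 'a set" where "D i = [B - C, B \<inter> C, C - B] ! i" for i
  define w :: "nat \<Rightarrow> bool \<Rightarrow> real" where
    "w i s = (if i = 1 then 0 else if i = 0 then (if s then 0 else 1) else (if s then 1 else 0))" for i s
  have I: "{..<3} = {0, 1, 2::nat}" by auto
  have D: "D 0 = B - C" "D 1 = B \<inter> C" "D 2 = C - B" by (simp_all add: D_def)
  have D_R: "D i \<in> R" if "i \<in> {..<3}" for i
    using that B C R_sets[OF B] R_sets[OF C] unfolding I
    by (auto simp: D D[simplified] intro: R_subset_closed[of B] R_subset_closed[of C])
  have "expectation (\<lambda>\<omega>. \<Prod>i\<in>{..<3}. w i True ^ num True (D i) \<omega> * w i False ^ num False (D i) \<omega>)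
    = exp (- (\<Sum>i\<in>{..<3}. (1 - w i True) * measure (intensity True) (D i) + (1 - w i False) * measure (intensity False) (D i)))"
  proof (rule joint_pgf)
    show "disjoint_family_on D {..<3}"
      unfolding I by (auto simp: disjoint_family_on_def D D[simplified])
  qed (use D_R in \<open>auto simp: w_def\<close>)
  also have "(\<Sum>i\<in>{..<3}. (1 - w i True) * measure (intensity True) (D i) + (1 - w i False) * measure (intensity False) (D i))
      = measure (intensity True) B + measure (intensity False) C"
    unfolding I using intensity_split[OF B R_sets[OF C], of True] intensity_split[OF C R_sets[OF B], of False]
    by (simp add: w_def D D[simplified] Int_commute)
  also have "(\<lambda>\<omega>. \<Prod>i\<in>{..<3}. w i True ^ num True (D i) \<omega> * w i False ^ num False (D i) \<omega>)
      = (\<lambda>\<omega>. of_bool (num True B \<omega> = 0 \<and> num False C \<omega> = 0))"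
    unfolding I using num_split[OF B, of True _ C] num_split[OF C, of False _ B]
    by (auto simp: w_def D D[simplified] Int_commute power_0_left fun_eq_iff)
  also have "expectation (\<lambda>\<omega>. of_bool (num True B \<omega> = 0 \<and> num False C \<omega> = 0))
      = expectation (indicator {\<omega>\<in>space P. num True B \<omega> = 0 \<and> num False C \<omega> = 0})"
    by (intro Bochner_Integration.integral_cong) (auto simp: indicator_def)
  finally show ?thesis
    by (simp add: Int_absorb2 flip: exp_add)
qed

lemma prob_void_single:
  assumes "B \<in> R"
  shows "prob {\<omega>\<in>space P. num s B \<omega> = 0} = exp (- measure (intensity s) B)"
  using num_poisson[OF assms, of s 0] by simp

definition voids :: "bool \<Rightarrow> 'a set set \<Rightarrow> 'w set set" where
  "voids s \<D> = {{\<omega>\<in>space P. num s D \<omega> = 0} |D. D \<in> \<D>}"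

lemma voids_events: "\<D> \<subseteq> R \<Longrightarrow> voids s \<D> \<subseteq> events"
  by (auto simp: voids_def intro: num_event)

lemma num_eq_0_Un_iff:
  assumes "B \<in> R" "C \<in> R"
  shows "num s (B \<union> C) \<omega> = 0 \<longleftrightarrow> num s B \<omega> = 0 \<and> num s C \<omega> = 0"
  using finite_T[OF assms(1), of s \<omega>] finite_T[OF assms(2), of s \<omega>]
  by (simp add: num_def Int_Un_distrib)

lemma Int_stable_voids:
  assumes "\<D> \<subseteq> R" "\<And>C D. C \<in> \<D> \<Longrightarrow> D \<in> \<D> \<Longrightarrow> C \<union> D \<in> \<D>"
  shows "Int_stable (voids s \<D>)"
proof (rule Int_stableI)
  fix a b assume "a \<in> voids s \<D>" "b \<in> voids s \<D>"
  then obtain C D where CD: "C \<in> \<D>" "D \<in> \<D>"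
      "a = {\<omega>\<in>space P. num s C \<omega> = 0}" "b = {\<omega>\<in>space P. num s D \<omega> = 0}"
    by (auto simp: voids_def)
  then have "a \<inter> b = {\<omega>\<in>space P. num s (C \<union> D) \<omega> = 0}"
    using assms(1) num_eq_0_Un_iff[of C D s] by auto
  then show "a \<inter> b \<in> voids s \<D>"
    using assms(2)[OF CD(1,2)] by (auto simp: voids_def)
qed

lemma space_sigma_voids: "space (sigma (space P) (voids s \<D>)) = space P"
  by (rule space_measure_of) (auto simp: voids_def)

lemma sets_sigma_voids: "sets (sigma (space P) (voids s \<D>)) = sigma_sets (space P) (voids s \<D>)"
  by (rule sets_measure_of) (auto simp: voids_def)

text \<open>A simple point process is determined by its void events: its points in a set are counted by
  the occupied cells of a fine partition.\<close>

lemma num_measurable_voids: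
  assumes B: "B \<in> R" and \<D>: "\<And>n j. B \<inter> cell n j \<in> \<D>"
  shows "(\<lambda>\<omega>. real (num s B \<omega>)) \<in> borel_measurable (sigma (space P) (voids s \<D>))"
    (is "_ \<in> borel_measurable ?N")
proof (rule borel_measurable_LIMSEQ_real)
  let ?E = "\<lambda>n j. {\<omega>\<in>space P. num s (B \<inter> cell n j) \<omega> = 0}"
  have E: "?E n j \<in> sets ?N" for n j
    using \<D>[of n j] unfolding sets_sigma_voids by (auto simp: voids_def intro!: sigma_sets.Basic)
  show "(\<lambda>\<omega>. \<Sum>j\<le>2 ^ n. 1 - indicator (?E n j) \<omega> :: real) \<in> borel_measurable ?N" for n
    by (intro borel_measurable_sum borel_measurable_diff borel_measurable_const borel_measurable_indicator E)
  fix \<omega> assume "\<omega> \<in> space ?N"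
  then have \<omega>: "\<omega> \<in> space P" by (simp add: space_sigma_voids)
  have fin: "finite (T s \<omega> \<inter> B)" and sub: "T s \<omega> \<inter> B \<subseteq> space S"
    using finite_T[OF B] T_subset[of s \<omega>] by auto
  have "eventually (\<lambda>n. inj_on (idx n) (T s \<omega> \<inter> B)) sequentially"
    using fin sub by (rule eventually_inj_on_idx)
  then have "eventually (\<lambda>n. (\<Sum>j\<le>2 ^ n. 1 - indicator (?E n j) \<omega>) = real (num s B \<omega>)) sequentially"
  proof eventually_elim
    case (elim n)
    have "(\<Sum>j\<le>2 ^ n. 1 - indicator (?E n j) \<omega> :: real) = (\<Sum>j\<in>{..2 ^ n}. if j \<in> idx n ` (T s \<omega> \<inter> B) then 1 else 0)"
    proof (intro sum.cong refl)
      fix j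
      have "num s (B \<inter> cell n j) \<omega> = 0 \<longleftrightarrow> j \<notin> idx n ` (T s \<omega> \<inter> B)"
        using finite_T[OF cell_in_R[OF B], of s \<omega> n j] sub by (auto simp: num_def cell_def)
      then show "1 - indicator (?E n j) \<omega> = (if j \<in> idx n ` (T s \<omega> \<inter> B) then 1 else (0::real))"
        using \<omega> by (simp add: indicator_def)
    qed
    also have "\<dots> = real (card ({..2 ^ n} \<inter> idx n ` (T s \<omega> \<inter> B)))"
      by (simp add: sum.If_cases)
    also have "{..2 ^ n} \<inter> idx n ` (T s \<omega> \<inter> B) = idx n ` (T s \<omega> \<inter> B)"
      using idx_le sub by blast
    finally show ?case
      by (simp add: card_image[OF elim] num_def)
  qed
  then show "(\<lambda>n. \<Sum>j\<le>2 ^ n. 1 - indicator (?E n j) \<omega>) \<longlonglongrightarrow> real (num s B \<omega>)"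
    by (rule tendsto_eventually)
qed

text \<open>The void events of the subsets of \<open>B i\<close> in R form a \<pi>-system that
  determines the count on \<open>B i\<close>. For subsets of disjoint sets, joint voidness is
  voidness of the union, and additivity of the intensity turns its exponential into a
  product.\<close>

lemma num_increments: "independent_increments P R (\<lambda>\<omega> B. real (num s B \<omega>))"
  unfolding independent_increments_def
proof (intro allI impI, elim conjE)
  fix n :: nat and B :: "nat \<Rightarrow> 'a set"
  assume B: "\<forall>i<n. B i \<in> R" and disj: "disjoint_family_on B {..<n}"
  let ?D = "\<lambda>i. {D \<in> R. D \<subseteq> B i}"
  have "indep_sets (\<lambda>i. voids s (?D i)) {..<n}"
  proof (rule indep_setsI)
    show "voids s (?D i) \<subseteq> events" for i
      by (rule voids_events) auto
    fix A J
    assume J: "J \<noteq> {}" "J \<subseteq> {..<n}" "finite J" and "\<forall>j\<in>J. A j \<in> voids s (?D j)"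
    then have "\<forall>j\<in>J. \<exists>D. A j = {\<omega>\<in>space P. num s D \<omega> = 0} \<and> D \<in> R \<and> D \<subseteq> B j"
      by (auto simp: voids_def)
    then obtain D where D: "\<And>j. j \<in> J \<Longrightarrow> A j = {\<omega>\<in>space P. num s (D j) \<omega> = 0}"
        "\<And>j. j \<in> J \<Longrightarrow> D j \<in> R" "\<And>j. j \<in> J \<Longrightarrow> D j \<subseteq> B j"
      by metis
    have disjD: "disjoint_family_on D J"
      using disjoint_family_on_mono[OF J(2) disj] D(3) unfolding disjoint_family_on_def by blast
    have UD: "(\<Union>j\<in>J. D j) \<in> R"
      using J D(2) by (intro finite_UN) auto
    have "T s \<omega> \<inter> (\<Union>j\<in>J. D j) = {} \<longleftrightarrow> (\<forall>j\<in>J. T s \<omega> \<inter> D j = {})" for \<omega>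
      by blast
    then have "num s (\<Union>j\<in>J. D j) \<omega> = 0 \<longleftrightarrow> (\<forall>j\<in>J. num s (D j) \<omega> = 0)" for \<omega>
      using finite_T[OF UD, of s \<omega>] finite_T[OF D(2), of _ s \<omega>] by (simp add: num_def)
    then have "(\<Inter>j\<in>J. A j) = {\<omega>\<in>space P. num s (\<Union>j\<in>J. D j) \<omega> = 0}"
      using J(1) D(1) by auto
    then have "prob (\<Inter>j\<in>J. A j) = exp (- measure (intensity s) (\<Union>j\<in>J. D j))"
      by (simp add: prob_void_single[OF UD])
    also have "measure (intensity s) (\<Union>j\<in>J. D j) = (\<Sum>j\<in>J. measure (intensity s) (D j))"
      using J D(2) R_sets disjD
      by (intro measure_finite_Union) (auto simp: emeasure_intensity_R)
    also have "exp (- \<dots>) = (\<Prod>j\<in>J. prob (A j))"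
      using J D by (simp add: prob_void_single exp_sum flip: sum_negf)
    finally show "prob (\<Inter>j\<in>J. A j) = (\<Prod>j\<in>J. prob (A j))" .
  qed
  then have "indep_sets (\<lambda>i. sigma_sets (space P) (voids s (?D i))) {..<n}"
    by (rule indep_sets_sigma) (auto intro: Int_stable_voids)
  then have "indep_sets (\<lambda>i. {(\<lambda>\<omega>. real (num s (B i) \<omega>)) -` A \<inter> space P |A. A \<in> sets borel}) {..<n}"
  proof (rule indep_sets_mono_sets)
    fix i assume "i \<in> {..<n}"
    then have "B i \<in> R" using B by simp
    then have "(\<lambda>\<omega>. real (num s (B i) \<omega>)) \<in> borel_measurable (sigma (space P) (voids s (?D i)))"
      by (intro num_measurable_voids) (auto intro: cell_in_R)
    from measurable_sets[OF this]
    show "{(\<lambda>\<omega>. real (num s (B i) \<omega>)) -` A \<inter> space P |A. A \<in> sets borel}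
        \<subseteq> sigma_sets (space P) (voids s (?D i))"
      by (auto simp: space_sigma_voids sets_sigma_voids)
  qed
  then show "indep_vars (\<lambda>_. borel) (\<lambda>i \<omega>. real (num s (B i) \<omega>)) {..<n}"
    using num_measurable B by (auto simp: indep_vars_def2)
qed

lemma random_measure_points: "random_measure P S R (points s)"
  unfolding random_measure_def
  by (rule measurable_locally_finite_algebraI)
    (simp_all add: emeasure_points_R num_measurable)

lemma poisson_points: "poisson_point_process P S R (points s)"
  unfolding poisson_point_process_def
proof (intro conjI random_measure_points)
  show "AE \<omega> in P. \<forall>B\<in>R. measure (points s \<omega>) B \<in> \<nat>"
    by (simp add: measure_points_R)
  show "independent_increments P R (\<lambda>\<omega> B. measure (points s \<omega>) B)"
    unfolding independent_increments_def
  proof (intro allI impI, elim conjE)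
    fix n :: nat and B :: "nat \<Rightarrow> 'a set"
    assume B: "\<forall>i<n. B i \<in> R" and disj: "disjoint_family_on B {..<n}"
    have "indep_vars (\<lambda>_. borel) (\<lambda>i \<omega>. measure (points s \<omega>) (B i)) {..<n}
        \<longleftrightarrow> indep_vars (\<lambda>_. borel) (\<lambda>i \<omega>. real (num s (B i) \<omega>)) {..<n}"
      using B by (intro indep_vars_cong refl) (simp_all add: measure_points_R)
    then show "indep_vars (\<lambda>_. borel) (\<lambda>i \<omega>. measure (points s \<omega>) (B i)) {..<n}"
      using num_increments[of s, unfolded independent_increments_def, rule_format, of n B] B disj by simp
  qed
  show "\<exists>\<mu>. sets \<mu> = sets S \<and> (\<forall>B\<in>R. emeasure \<mu> B < \<infinity> \<and>
      (\<forall>k::nat. prob {\<omega> \<in> space P. measure (points s \<omega>) B = real k} = measure \<mu> B ^ k / fact k * exp (- measure \<mu> B)))"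
    by (rule exI[of _ "intensity s"]) (simp add: emeasure_intensity_R measure_points_R num_poisson)
qed

text \<open>\<open>prob_void\<close> factorizes for arbitrary, possibly overlapping sets, so the two
  full systems of void events are independent. The evaluations on R generate the \<sigma>-algebra of
  locally finite measures and are measurable with respect to the void events, which lifts
  independence to the random measures.\<close>

lemma indep_points:
  "indep_var (locally_finite_algebra S R) (points True) (locally_finite_algebra S R) (points False)"
  unfolding indep_var_eq
proof (intro conjI)
  show "points True \<in> P \<rightarrow>\<^sub>M locally_finite_algebra S R" "points False \<in> P \<rightarrow>\<^sub>M locally_finite_algebra S R"
    using random_measure_points by (auto simp: random_measure_def)
  have "indep_set (voids True R) (voids False R)"
  proof (rule indep_setI[OF voids_events voids_events])
    fix a b assume "a \<in> voids True R" "b \<in> voids False R"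
    then obtain B C where BC: "B \<in> R" "C \<in> R"
        "a = {\<omega>\<in>space P. num True B \<omega> = 0}" "b = {\<omega>\<in>space P. num False C \<omega> = 0}"
      by (auto simp: voids_def)
    then have "a \<inter> b = {\<omega>\<in>space P. num True B \<omega> = 0 \<and> num False C \<omega> = 0}"
      by auto
    then show "prob (a \<inter> b) = prob a * prob b"
      using BC by (simp add: prob_void prob_void_single)
  qed auto
  then have "indep_set (sigma_sets (space P) (voids True R)) (sigma_sets (space P) (voids False R))"
    by (rule indep_set_sigma_sets) (auto intro: Int_stable_voids)
  moreover have "sigma_sets (space P) {points s -` A \<inter> space P |A. A \<in> sets (locally_finite_algebra S R)}
      \<subseteq> sigma_sets (space P) (voids s R)" for s
  proof (rule sigma_sets_mono)
    have "points s \<in> sigma (space P) (voids s R) \<rightarrow>\<^sub>M locally_finite_algebra S R"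
    proof (rule measurable_locally_finite_algebraI)
      fix C assume "C \<in> R"
      then show "(\<lambda>\<omega>. emeasure (points s \<omega>) C) \<in> borel_measurable (sigma (space P) (voids s R))"
        using num_measurable_voids[of C R s] by (simp add: emeasure_points_R cell_in_R)
    qed (simp_all add: emeasure_points_R)
    from measurable_sets[OF this]
    show "{points s -` A \<inter> space P |A. A \<in> sets (locally_finite_algebra S R)} \<subseteq> sigma_sets (space P) (voids s R)"
      by (auto simp: space_sigma_voids sets_sigma_voids)
  qed
  ultimately show "indep_set
      (sigma_sets (space P) {points True -` A \<inter> space P |A. A \<in> sets (locally_finite_algebra S R)})
      (sigma_sets (space P) {points False -` A \<inter> space P |A. A \<in> sets (locally_finite_algebra S R)})"
    unfolding indep_sets2_eq by blast
qed

end

section \<open>Atomic set functions\<close>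

definition atom_indices :: "(bool \<Rightarrow> enat) \<Rightarrow> (bool \<Rightarrow> nat \<Rightarrow> 'a) \<Rightarrow> bool \<Rightarrow> 'a set \<Rightarrow> nat set" where
  "atom_indices \<kappa> \<sigma> s B = {k. enat k < \<kappa> s \<and> \<sigma> s k \<in> B}"

definition atom_mass ::
    "(bool \<Rightarrow> enat) \<Rightarrow> (bool \<Rightarrow> nat \<Rightarrow> real) \<Rightarrow> (bool \<Rightarrow> nat \<Rightarrow> 'a) \<Rightarrow> bool \<Rightarrow> 'a set \<Rightarrow> real" where
  "atom_mass \<kappa> \<beta> \<sigma> s B = (\<Sum>\<^sub>\<infinity>k\<in>atom_indices \<kappa> \<sigma> s B. \<beta> s k)"

context localized_borel_space
begin

text \<open>The pathwise content, at a fixed \<omega>, of an atomic decomposition whose diffuse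
  parts vanish. Weights are arbitrary positive reals, since the converse implication uses this
  before the weights are known to be 1.\<close>

definition is_atomic ::
    "(bool \<Rightarrow> enat) \<Rightarrow> (bool \<Rightarrow> nat \<Rightarrow> real) \<Rightarrow> (bool \<Rightarrow> nat \<Rightarrow> 'a) \<Rightarrow> ('a set \<Rightarrow> real) \<Rightarrow> bool" where
  "is_atomic \<kappa> \<beta> \<sigma> \<mu> \<longleftrightarrow>
     (\<forall>s k. enat k < \<kappa> s \<longrightarrow> \<sigma> s k \<in> space S \<and> 0 < \<beta> s k) \<and>
     inj_on (\<lambda>(s, k). \<sigma> s k) {(s, k). enat k < \<kappa> s} \<and>
     (\<forall>B\<in>R. (\<forall>s. \<beta> s summable_on atom_indices \<kappa> \<sigma> s B) \<and>
       \<mu> B = atom_mass \<kappa> \<beta> \<sigma> True B - atom_mass \<kappa> \<beta> \<sigma> False B)"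

lemma is_atomicD:
  assumes "is_atomic \<kappa> \<beta> \<sigma> \<mu>"
  shows "enat k < \<kappa> s \<Longrightarrow> \<sigma> s k \<in> space S"
    and "enat k < \<kappa> s \<Longrightarrow> 0 < \<beta> s k"
    and "enat k < \<kappa> s \<Longrightarrow> enat l < \<kappa> s' \<Longrightarrow> \<sigma> s k = \<sigma> s' l \<Longrightarrow> s = s' \<and> k = l"
    and "B \<in> R \<Longrightarrow> \<beta> s summable_on atom_indices \<kappa> \<sigma> s B"
    and "B \<in> R \<Longrightarrow> \<mu> B = atom_mass \<kappa> \<beta> \<sigma> True B - atom_mass \<kappa> \<beta> \<sigma> False B"
  using assms unfolding is_atomic_def inj_on_def by auto

lemma atom_mass_nonneg:
  assumes "is_atomic \<kappa> \<beta> \<sigma> \<mu>"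
  shows "0 \<le> atom_mass \<kappa> \<beta> \<sigma> s B"
  unfolding atom_mass_def
  using is_atomicD(2)[OF assms] by (intro infsum_nonneg) (auto simp: atom_indices_def less_imp_le)

lemma atom_mass_mono:
  assumes "is_atomic \<kappa> \<beta> \<sigma> \<mu>" "B \<in> R" "E \<in> R" "E \<subseteq> B"
  shows "atom_mass \<kappa> \<beta> \<sigma> s E \<le> atom_mass \<kappa> \<beta> \<sigma> s B"
  unfolding atom_mass_def using assms
  by (intro infsum_mono2 is_atomicD(4)) (auto simp: atom_indices_def intro: less_imp_le is_atomicD(2))

lemma le_atom_mass:
  assumes "is_atomic \<kappa> \<beta> \<sigma> \<mu>" "B \<in> R" "enat k < \<kappa> s" "\<sigma> s k \<in> B"
  shows "\<beta> s k \<le> atom_mass \<kappa> \<beta> \<sigma> s B"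
proof -
  have "sum (\<beta> s) {k} \<le> atom_mass \<kappa> \<beta> \<sigma> s B"
    unfolding atom_mass_def using assms
    by (intro finite_sum_le_infsum is_atomicD(4)) (auto simp: atom_indices_def intro: less_imp_le is_atomicD(2))
  then show ?thesis by simp
qed

text \<open>The supremum is attained at the set of the atoms of the given sign in \<open>B\<close>.\<close>

lemma SUP_is_atomic:
  assumes \<mu>: "is_atomic \<kappa> \<beta> \<sigma> \<mu>" and B: "B \<in> R"
  shows "(SUP E\<in>{E \<in> sets S. E \<subseteq> B}. (if s then \<mu> E else - \<mu> E)) = atom_mass \<kappa> \<beta> \<sigma> s B"
proof (rule cSup_eq_maximum)
  have signed: "(if s then \<mu> E else - \<mu> E) = atom_mass \<kappa> \<beta> \<sigma> s E - atom_mass \<kappa> \<beta> \<sigma> (\<not> s) E" if "E \<in> R" for E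
    using is_atomicD(5)[OF \<mu> that] by (cases s) auto
  let ?E = "\<sigma> s ` atom_indices \<kappa> \<sigma> s B"
  have "?E \<subseteq> B" by (auto simp: atom_indices_def)
  have "?E \<in> sets S"
    using is_atomicD(1)[OF \<mu>] by (intro countable_sets) (auto simp: atom_indices_def)
  then have E: "?E \<in> R"
    using B \<open>?E \<subseteq> B\<close> by (intro R_subset_closed[OF B])
  \<comment> \<open>Distinctness of the points across both signs keeps atoms of the opposite sign
    out of \<open>?E\<close>.\<close>
  have "atom_indices \<kappa> \<sigma> s ?E = atom_indices \<kappa> \<sigma> s B" "atom_indices \<kappa> \<sigma> (\<not> s) ?E = {}"
    using is_atomicD(3)[OF \<mu>] by (auto simp: atom_indices_def)
  then have "(if s then \<mu> ?E else - \<mu> ?E) = atom_mass \<kappa> \<beta> \<sigma> s B"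
    unfolding signed[OF E] by (simp add: atom_mass_def)
  then show "atom_mass \<kappa> \<beta> \<sigma> s B \<in> (\<lambda>E. if s then \<mu> E else - \<mu> E) ` {E \<in> sets S. E \<subseteq> B}"
    using \<open>?E \<in> sets S\<close> \<open>?E \<subseteq> B\<close> by (intro image_eqI[of _ _ ?E]) auto
  fix y assume "y \<in> (\<lambda>E. if s then \<mu> E else - \<mu> E) ` {E \<in> sets S. E \<subseteq> B}"
  then obtain E where "y = (if s then \<mu> E else - \<mu> E)" "E \<in> sets S" "E \<subseteq> B" by blast
  then show "y \<le> atom_mass \<kappa> \<beta> \<sigma> s B"
    using signed[of E] R_subset_closed[OF B, of E] atom_mass_nonneg[OF \<mu>, of "\<not> s" E]
      atom_mass_mono[OF \<mu> B, of E s] by simp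
qed

text \<open>Summability of the constant 1 forces a finite index set, and distinct points make the
  labelling injective, so mass, number of indices and number of points coincide.\<close>

lemma card_atoms_eq_atom_mass:
  assumes \<mu>: "is_atomic \<kappa> \<beta> \<sigma> \<mu>" and one: "\<And>s k. enat k < \<kappa> s \<Longrightarrow> \<beta> s k = 1" and B: "B \<in> R"
  shows "finite (atom_indices \<kappa> \<sigma> s B)"
    and "finite ({\<sigma> s k |k. enat k < \<kappa> s} \<inter> B)"
    and "card ({\<sigma> s k |k. enat k < \<kappa> s} \<inter> B) = card (atom_indices \<kappa> \<sigma> s B)"
    and "atom_mass \<kappa> \<beta> \<sigma> s B = real (card ({\<sigma> s k |k. enat k < \<kappa> s} \<inter> B))"
proof -
  have "(\<lambda>_. 1::real) summable_on atom_indices \<kappa> \<sigma> s B"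
    using is_atomicD(4)[OF \<mu> B, of s] one
    by (subst summable_on_cong[of _ _ "\<beta> s"]) (auto simp: atom_indices_def)
  then show fin: "finite (atom_indices \<kappa> \<sigma> s B)"
    using infsum_diverge_constant[of "atom_indices \<kappa> \<sigma> s B" "1::real"] by auto
  have img: "{\<sigma> s k |k. enat k < \<kappa> s} \<inter> B = \<sigma> s ` atom_indices \<kappa> \<sigma> s B"
    by (auto simp: atom_indices_def)
  have inj: "inj_on (\<sigma> s) (atom_indices \<kappa> \<sigma> s B)"
    using is_atomicD(3)[OF \<mu>] by (auto simp: inj_on_def atom_indices_def)
  show "finite ({\<sigma> s k |k. enat k < \<kappa> s} \<inter> B)"
    using fin img by simp
  show card: "card ({\<sigma> s k |k. enat k < \<kappa> s} \<inter> B) = card (atom_indices \<kappa> \<sigma> s B)"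
    unfolding img by (rule card_image[OF inj])
  have "atom_mass \<kappa> \<beta> \<sigma> s B = (\<Sum>\<^sub>\<infinity>k\<in>atom_indices \<kappa> \<sigma> s B. 1)"
    unfolding atom_mass_def by (rule infsum_cong) (auto simp: atom_indices_def one)
  then show "atom_mass \<kappa> \<beta> \<sigma> s B = real (card ({\<sigma> s k |k. enat k < \<kappa> s} \<inter> B))"
    using fin by (simp add: card)
qed

end

context localized_prob_space
begin

lemma random_atoms_in_space:
  assumes "random_atoms P S \<kappa> \<beta> \<sigma>" "\<omega> \<in> space P" "enat k < \<kappa> s \<omega>"
  shows "\<sigma> s k \<omega> \<in> space S"
proof -
  have "\<sigma> s k \<in> restrict_space P {\<omega> \<in> space P. enat k < \<kappa> s \<omega>} \<rightarrow>\<^sub>M S"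
    using assms(1) by (simp add: random_atoms_def)
  from measurable_space[OF this, of \<omega>] show ?thesis
    using assms by (simp add: space_restrict_space)
qed

text \<open>\<open>\<sigma> s k\<close> is measurable only on the event that the atom exists. As
  this event is measurable, preimages in the restricted space are events of P.\<close>

lemma random_atoms_event:
  assumes "random_atoms P S \<kappa> \<beta> \<sigma>" "B \<in> sets S"
  shows "{\<omega>\<in>space P. enat k < \<kappa> s \<omega> \<and> \<sigma> s k \<omega> \<in> B} \<in> events"
proof -
  let ?E = "{\<omega> \<in> space P. enat k < \<kappa> s \<omega>}"
  have "\<kappa> s \<in> P \<rightarrow>\<^sub>M count_space UNIV" and \<sigma>: "\<sigma> s k \<in> restrict_space P ?E \<rightarrow>\<^sub>M S"
    using assms(1) by (auto simp: random_atoms_def)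
  then have "\<kappa> s -` {x. enat k < x} \<inter> space P \<in> events"
    by (intro measurable_sets) auto
  also have "\<kappa> s -` {x. enat k < x} \<inter> space P = ?E" by auto
  finally have E: "?E \<in> events" .
  from measurable_sets[OF \<sigma> assms(2)]
  have "\<sigma> s k -` B \<inter> space (restrict_space P ?E) \<in> sets (restrict_space P ?E)" .
  then have "\<sigma> s k -` B \<inter> space (restrict_space P ?E) \<in> events"
    using E by (subst (asm) sets_restrict_space_iff) auto
  also have "\<sigma> s k -` B \<inter> space (restrict_space P ?E) = {\<omega>\<in>space P. enat k < \<kappa> s \<omega> \<and> \<sigma> s k \<omega> \<in> B}"
    by (auto simp: space_restrict_space)
  finally show ?thesis .
qed

text \<open>A measure of total mass 0 vanishes on all sets of R simultaneously by monotonicity. All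
  almost sure conditions are merged, so that the later arguments are pathwise and uniform in
  B.\<close>

lemma atomic_decomposition_AE:
  assumes dec: "atomic_decomposition P S R \<xi> \<alpha> \<kappa> \<beta> \<sigma>"
    and \<alpha>: "AE \<omega> in P. \<forall>s. emeasure (\<alpha> s \<omega>) (space S) = 0"
  shows "AE \<omega> in P. is_atomic (\<lambda>s. \<kappa> s \<omega>) (\<lambda>s k. \<beta> s k \<omega>) (\<lambda>s k. \<sigma> s k \<omega>) (\<xi> \<omega>)"
proof -
  have atoms: "random_atoms P S \<kappa> \<beta> \<sigma>"
    and \<alpha>_meas: "\<And>s. \<alpha> s \<in> P \<rightarrow>\<^sub>M locally_finite_algebra S R"
    and sums: "AE \<omega> in P. \<forall>B\<in>R.
        (\<forall>s. (\<lambda>k. \<beta> s k \<omega>) summable_on {k. enat k < \<kappa> s \<omega> \<and> \<sigma> s k \<omega> \<in> B}) \<and>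
        \<xi> \<omega> B = measure (\<alpha> True \<omega>) B - measure (\<alpha> False \<omega>) B
          + (\<Sum>\<^sub>\<infinity>k\<in>{k. enat k < \<kappa> True \<omega> \<and> \<sigma> True k \<omega> \<in> B}. \<beta> True k \<omega>)
          - (\<Sum>\<^sub>\<infinity>k\<in>{k. enat k < \<kappa> False \<omega> \<and> \<sigma> False k \<omega> \<in> B}. \<beta> False k \<omega>)"
    using dec by (auto simp: atomic_decomposition_def diffuse_random_measure_def random_measure_def)
  have pos: "AE \<omega> in P. \<forall>s k. enat k < \<kappa> s \<omega> \<longrightarrow> 0 < \<beta> s k \<omega>"
    and inj: "AE \<omega> in P. inj_on (\<lambda>(s, k). \<sigma> s k \<omega>) {(s, k). enat k < \<kappa> s \<omega>}"
    using atoms by (auto simp: random_atoms_def)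
  show ?thesis
    using sums pos inj \<alpha> AE_space
  proof eventually_elim
    case (elim \<omega>)
    have null: "measure (\<alpha> s \<omega>) B = 0" if "B \<in> R" for s B
    proof -
      have "sets (\<alpha> s \<omega>) = sets S"
        using measurable_space[OF \<alpha>_meas elim(5)] by (simp add: space_locally_finite_algebra)
      then have "emeasure (\<alpha> s \<omega>) B \<le> emeasure (\<alpha> s \<omega>) (space S)"
        using R_sets[OF that] by (intro emeasure_mono) (auto dest: sets.sets_into_space)
      then show ?thesis
        using elim(4) by (simp add: measure_def)
    qed
    show ?case
      unfolding is_atomic_def atom_mass_def atom_indices_def
      using elim random_atoms_in_space[OF atoms elim(5)] by (auto simp: null)
  qed
qed

end

section \<open>The two implications\<close>

context localized_prob_space
begin

lemma random_signed_measure_measurable: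
  assumes "random_signed_measure P R \<xi>" "B \<in> R"
  shows "(\<lambda>\<omega>. \<xi> \<omega> B) \<in> borel_measurable P"
proof -
  have "\<xi> \<in> P \<rightarrow>\<^sub>M (\<Pi>\<^sub>M B\<in>R. borel)"
    using assms(1) unfolding random_signed_measure_def signed_measure_algebra_def
    by (simp add: measurable_restrict_space2_iff)
  from measurable_compose[OF this measurable_component_singleton[OF assms(2)]]
  show ?thesis .
qed

lemma independent_increments_AE_cong:
  assumes \<xi>: "independent_increments P R \<xi>"
    and \<eta>: "\<And>B. B \<in> R \<Longrightarrow> (\<lambda>\<omega>. \<eta> \<omega> B) \<in> borel_measurable P"
    and eq: "\<And>B. B \<in> R \<Longrightarrow> AE \<omega> in P. \<xi> \<omega> B = \<eta> \<omega> B"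
  shows "independent_increments P R \<eta>"
  unfolding independent_increments_def
proof (intro allI impI, elim conjE)
  fix n :: nat and B :: "nat \<Rightarrow> 'a set"
  assume B: "\<forall>i<n. B i \<in> R" "disjoint_family_on B {..<n}"
  show "indep_vars (\<lambda>_. borel) (\<lambda>i \<omega>. \<eta> \<omega> (B i)) {..<n}"
  proof (rule indep_vars_AE_cong)
    show "indep_vars (\<lambda>_. borel) (\<lambda>i \<omega>. \<xi> \<omega> (B i)) {..<n}"
      using \<xi> B unfolding independent_increments_def by simp
  qed (use B \<eta> eq in auto)
qed

proposition skellam_if_independent_increments:
  assumes simple: "simple_signed_point_process P S R \<xi>"
    and incr: "independent_increments P R \<xi>"
    and no_fixed: "no_fixed_atoms P S \<xi>"
  shows "skellam_point_process P S R \<xi>"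
proof -
  obtain \<alpha> \<kappa> \<beta> \<sigma> where dec: "atomic_decomposition P S R \<xi> \<alpha> \<kappa> \<beta> \<sigma>"
      and \<alpha>: "AE \<omega> in P. \<forall>s. emeasure (\<alpha> s \<omega>) (space S) = 0"
      and \<beta>: "AE \<omega> in P. \<forall>s k. enat k < \<kappa> s \<omega> \<longrightarrow> \<beta> s k \<omega> = 1"
    using simple by (auto simp: simple_signed_point_process_def)
  have rsm: "random_signed_measure P R \<xi>"
    using simple by (simp add: simple_signed_point_process_def)
  have atoms: "random_atoms P S \<kappa> \<beta> \<sigma>"
    using dec by (simp add: atomic_decomposition_def)
  have "AE \<omega> in P. is_atomic (\<lambda>s. \<kappa> s \<omega>) (\<lambda>s k. \<beta> s k \<omega>) (\<lambda>s k. \<sigma> s k \<omega>) (\<xi> \<omega>) \<and>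
      (\<forall>s k. enat k < \<kappa> s \<omega> \<longrightarrow> \<beta> s k \<omega> = 1)"
    using atomic_decomposition_AE[OF dec \<alpha>] \<beta> by eventually_elim simp
  \<comment> \<open>The set of good \<omega> involves all B in R and may fail to be measurable; a
    measurable null set covering its complement takes its place.\<close>
  then obtain N where N: "{\<omega>\<in>space P. \<not> (is_atomic (\<lambda>s. \<kappa> s \<omega>) (\<lambda>s k. \<beta> s k \<omega>) (\<lambda>s k. \<sigma> s k \<omega>) (\<xi> \<omega>) \<and>
      (\<forall>s k. enat k < \<kappa> s \<omega> \<longrightarrow> \<beta> s k \<omega> = 1))} \<subseteq> N" "emeasure P N = 0" "N \<in> events"
    by (rule AE_E)
  define G where "G = space P - N"
  have G_event: "G \<in> events" using N by (simp add: G_def)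
  have AE_G: "AE \<omega> in P. \<omega> \<in> G"
    using N by (intro AE_I[of _ _ N]) (auto simp: G_def)
  have atomic: "is_atomic (\<lambda>s. \<kappa> s \<omega>) (\<lambda>s k. \<beta> s k \<omega>) (\<lambda>s k. \<sigma> s k \<omega>) (\<xi> \<omega>)"
    and one: "enat k < \<kappa> s \<omega> \<Longrightarrow> \<beta> s k \<omega> = 1" if "\<omega> \<in> G" for \<omega> s k
    using that N by (auto simp: G_def)
  \<comment> \<open>Emptying the configurations off \<open>G\<close> makes the pathwise conditions
    of \<open>signed_points\<close> hold for every \<omega>.\<close>
  define T where "T s \<omega> = (if \<omega> \<in> G then {\<sigma> s k \<omega> |k. enat k < \<kappa> s \<omega>} else {})" for s \<omega>
  have cards: "finite (atom_indices (\<lambda>s. \<kappa> s \<omega>) (\<lambda>s k. \<sigma> s k \<omega>) s B)"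
      "finite ({\<sigma> s k \<omega> |k. enat k < \<kappa> s \<omega>} \<inter> B)"
      "card ({\<sigma> s k \<omega> |k. enat k < \<kappa> s \<omega>} \<inter> B) = card (atom_indices (\<lambda>s. \<kappa> s \<omega>) (\<lambda>s k. \<sigma> s k \<omega>) s B)"
      "atom_mass (\<lambda>s. \<kappa> s \<omega>) (\<lambda>s k. \<beta> s k \<omega>) (\<lambda>s k. \<sigma> s k \<omega>) s B
        = real (card ({\<sigma> s k \<omega> |k. enat k < \<kappa> s \<omega>} \<inter> B))"
    if "\<omega> \<in> G" "B \<in> R" for \<omega> s B
    using card_atoms_eq_atom_mass[OF atomic[OF that(1)] one[OF that(1)] that(2)] by auto
  have finite_T: "finite (T s \<omega> \<inter> B)" if "B \<in> R" for s \<omega> B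
    using cards(2)[OF _ that] by (simp add: T_def)
  have card_T: "real (card (T s \<omega> \<inter> B)) = atom_mass (\<lambda>s. \<kappa> s \<omega>) (\<lambda>s k. \<beta> s k \<omega>) (\<lambda>s k. \<sigma> s k \<omega>) s B"
    if "\<omega> \<in> G" "B \<in> R" for s \<omega> B
    using cards(4)[OF that] that by (simp add: T_def)
  have \<xi>_eq: "\<xi> \<omega> B = real (card (T True \<omega> \<inter> B)) - real (card (T False \<omega> \<inter> B))" if "\<omega> \<in> G" "B \<in> R" for \<omega> B
    using is_atomicD(5)[OF atomic[OF that(1)] that(2)] by (simp add: card_T that)
  have T_disjoint: "T True \<omega> \<inter> T False \<omega> = {}" for \<omega>
    using is_atomicD(3)[OF atomic, of \<omega> _ True _ False] by (auto simp: T_def)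
  have T_subset: "T s \<omega> \<subseteq> space S" for s \<omega>
    using is_atomicD(1)[OF atomic] by (auto simp: T_def)
  have count_measurable: "(\<lambda>\<omega>. real (card (T s \<omega> \<inter> B))) \<in> borel_measurable P" if B: "B \<in> R" for s B
  proof -
    let ?E = "\<lambda>k. {\<omega>\<in>space P. enat k < \<kappa> s \<omega> \<and> \<sigma> s k \<omega> \<in> B} \<inter> G"
    have "?E k \<in> events" for k
      by (rule sets.Int[OF random_atoms_event[OF atoms R_sets[OF B]] G_event])
    then have "(\<lambda>\<omega>. \<Sum>k. indicator (?E k) \<omega> :: real) \<in> borel_measurable P"
      by (intro borel_measurable_suminf borel_measurable_indicator)
    moreover have "(\<Sum>k. indicator (?E k) \<omega> :: real) = real (card (T s \<omega> \<inter> B))" if "\<omega> \<in> space P" for \<omega>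
    proof (cases "\<omega> \<in> G")
      case True
      let ?K = "atom_indices (\<lambda>s. \<kappa> s \<omega>) (\<lambda>s k. \<sigma> s k \<omega>) s B"
      have "(\<Sum>k. indicator (?E k) \<omega> :: real) = (\<Sum>k\<in>?K. indicator (?E k) \<omega>)"
        using cards(1)[OF True B] by (intro suminf_finite) (auto simp: atom_indices_def)
      also have "\<dots> = (\<Sum>k\<in>?K. 1)"
        using True that by (intro sum.cong) (auto simp: atom_indices_def)
      also have "\<dots> = real (card (T s \<omega> \<inter> B))"
        using cards(3)[OF True B] True by (simp add: T_def)
      finally show ?thesis .
    qed (simp add: T_def)
    ultimately show ?thesis
      by (subst (asm) measurable_cong) auto
  qed
  have T_incr: "independent_increments P R (\<lambda>\<omega> B. real (card (T True \<omega> \<inter> B)) - real (card (T False \<omega> \<inter> B)))"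
  proof (rule independent_increments_AE_cong[OF incr])
    fix B assume "B \<in> R"
    then show "AE \<omega> in P. \<xi> \<omega> B = real (card (T True \<omega> \<inter> B)) - real (card (T False \<omega> \<inter> B))"
      using AE_G \<xi>_eq by (auto elim: eventually_mono)
  qed (use count_measurable in auto)
  have T_no_fixed: "AE \<omega> in P. x \<notin> T s \<omega>" if x: "x \<in> space S" for x s
  proof -
    have "AE \<omega> in P. \<xi> \<omega> {x} = 0"
      using no_fixed x by (simp add: no_fixed_atoms_def)
    then show ?thesis
      using AE_G
    proof eventually_elim
      case (elim \<omega>)
      \<comment> \<open>Net mass 0 at x might arise from cancellation; disjointness of the two
        configurations excludes it, so neither contains x.\<close>
      then have "card (T True \<omega> \<inter> {x}) = card (T False \<omega> \<inter> {x})"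
        using \<xi>_eq[OF _ singleton_in_R[OF x]] by simp
      then show ?case
        using T_disjoint[of \<omega>] by (cases s; cases "x \<in> T True \<omega>"; cases "x \<in> T False \<omega>") auto
    qed
  qed
  interpret signed_points P S R T
    by unfold_locales
      (rule T_subset T_disjoint T_incr | erule finite_T count_measurable T_no_fixed)+
  have "jordan_decomposition P S R \<xi> (points True) (points False)"
    unfolding jordan_decomposition_def
  proof (intro conjI random_measure_points)
    show "AE \<omega> in P. \<forall>B\<in>R. measure (points True \<omega>) B = (SUP E\<in>{E \<in> sets S. E \<subseteq> B}. \<xi> \<omega> E) \<and>
        measure (points False \<omega>) B = (SUP E\<in>{E \<in> sets S. E \<subseteq> B}. - \<xi> \<omega> E)"
      using AE_G
    proof eventually_elim
      case (elim \<omega>)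
      show ?case
        using SUP_is_atomic[OF atomic[OF elim], of _ True] SUP_is_atomic[OF atomic[OF elim], of _ False]
        by (simp add: measure_points_R num_def card_T elim)
    qed
  qed
  moreover have "signed_point_process P S R \<xi>"
    unfolding signed_point_process_def
  proof (intro conjI exI)
    show "AE \<omega> in P. \<forall>s k. enat k < \<kappa> s \<omega> \<longrightarrow> \<beta> s k \<omega> \<in> \<nat>"
      using \<beta> by eventually_elim simp
  qed fact+
  ultimately show ?thesis
    unfolding skellam_point_process_def using poisson_points indep_points by blast
qed

section \<open>Independent Poisson processes and their difference\<close>

lemma locally_finite_event:
  assumes "finite J" "\<And>j. j \<in> J \<Longrightarrow> B j \<in> R" "\<And>j. j \<in> J \<Longrightarrow> A j \<in> sets (borel :: real measure)"
  shows "{M \<in> space (locally_finite_algebra S R). \<forall>j\<in>J. measure M (B j) \<in> A j} \<in> sets (locally_finite_algebra S R)"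
proof (rule sets.sets_Collect_finite_All[OF _ assms(1)])
  fix j assume j: "j \<in> J"
  have "(\<lambda>M. measure M (B j)) \<in> borel_measurable (locally_finite_algebra S R)"
    unfolding measure_def using measurable_emeasure_locally_finite[OF assms(2)[OF j]] by simp
  from measurable_sets[OF this assms(3)[OF j]]
  show "{M \<in> space (locally_finite_algebra S R). measure M (B j) \<in> A j} \<in> sets (locally_finite_algebra S R)"
    by (simp add: vimage_def Int_def conj_commute)
qed

lemma random_measure_measurable:
  assumes "random_measure P S R \<zeta>" "B \<in> R"
  shows "(\<lambda>\<omega>. measure (\<zeta> \<omega>) B) \<in> borel_measurable P"
proof -
  have "(\<lambda>\<omega>. emeasure (\<zeta> \<omega>) B) \<in> borel_measurable P"
    by (rule measurable_compose[OF _ measurable_emeasure_locally_finite[OF assms(2)]])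
      (use assms(1) in \<open>simp add: random_measure_def\<close>)
  then show ?thesis
    unfolding measure_def by simp
qed

text \<open>Independence of the random measures covers events in finitely many evaluations of each,
  which is the mixed factorization that \<open>indep_vars_diff\<close> asks for.\<close>

lemma increments_diff_independent:
  assumes indep: "indep_var (locally_finite_algebra S R) \<zeta> (locally_finite_algebra S R) \<zeta>'"
    and \<zeta>: "independent_increments P R (\<lambda>\<omega> B. measure (\<zeta> \<omega>) B)"
    and \<zeta>': "independent_increments P R (\<lambda>\<omega> B. measure (\<zeta>' \<omega>) B)"
  shows "independent_increments P R (\<lambda>\<omega> B. measure (\<zeta> \<omega>) B - measure (\<zeta>' \<omega>) B)"
  unfolding independent_increments_def
proof (intro allI impI, elim conjE)
  fix n :: nat and B :: "nat \<Rightarrow> 'a set"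
  assume B: "\<forall>i<n. B i \<in> R" "disjoint_family_on B {..<n}"
  have rv: "\<zeta> \<in> P \<rightarrow>\<^sub>M locally_finite_algebra S R" "\<zeta>' \<in> P \<rightarrow>\<^sub>M locally_finite_algebra S R"
    using indep by (auto simp: indep_var_eq)
  show "indep_vars (\<lambda>_. borel) (\<lambda>i \<omega>. measure (\<zeta> \<omega>) (B i) - measure (\<zeta>' \<omega>) (B i)) {..<n}"
  proof (rule indep_vars_diff)
    show "indep_vars (\<lambda>_. borel) (\<lambda>i \<omega>. measure (\<zeta> \<omega>) (B i)) {..<n}"
      using \<zeta> B unfolding independent_increments_def by simp
    show "indep_vars (\<lambda>_. borel) (\<lambda>i \<omega>. measure (\<zeta>' \<omega>) (B i)) {..<n}"
      using \<zeta>' B unfolding independent_increments_def by simp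
    fix J and A C :: "nat \<Rightarrow> real set"
    assume J: "J \<subseteq> {..<n}" "finite J" and AC: "\<And>j. j \<in> J \<Longrightarrow> A j \<in> sets borel \<and> C j \<in> sets borel"
    let ?F = "\<lambda>A. {M \<in> space (locally_finite_algebra S R). \<forall>j\<in>J. measure M (B j) \<in> A j}"
    have pre: "\<theta> -` ?F D \<inter> space P = {\<omega>\<in>space P. \<forall>j\<in>J. measure (\<theta> \<omega>) (B j) \<in> D j}"
      if "\<theta> \<in> P \<rightarrow>\<^sub>M locally_finite_algebra S R" for \<theta> and D :: "nat \<Rightarrow> real set"
      using measurable_space[OF that] by auto
    have "?F A \<in> sets (locally_finite_algebra S R)" "?F C \<in> sets (locally_finite_algebra S R)"
      using J AC B by (auto intro!: locally_finite_event)
    from indep_varD[OF indep this]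
    have "prob ((\<zeta> -` ?F A \<inter> space P) \<inter> (\<zeta>' -` ?F C \<inter> space P)) = prob (\<zeta> -` ?F A \<inter> space P) * prob (\<zeta>' -` ?F C \<inter> space P)"
      by (simp add: vimage_Times comp_def Int_ac)
    then show "prob ({\<omega>\<in>space P. \<forall>j\<in>J. measure (\<zeta> \<omega>) (B j) \<in> A j} \<inter> {\<omega>\<in>space P. \<forall>j\<in>J. measure (\<zeta>' \<omega>) (B j) \<in> C j}) =
        prob {\<omega>\<in>space P. \<forall>j\<in>J. measure (\<zeta> \<omega>) (B j) \<in> A j} * prob {\<omega>\<in>space P. \<forall>j\<in>J. measure (\<zeta>' \<omega>) (B j) \<in> C j}"
      unfolding pre[OF rv(1)] pre[OF rv(2)] .
  qed
qed

text \<open>The disjoint events X = 0, X = 1 and X \<ge> 2 have total probability at most 1, and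
  exp(-m) \<ge> 1 - m turns the complement into 1 - (1 - m)(1 + m).\<close>

lemma poisson_at_least_2:
  assumes X: "X \<in> borel_measurable P"
    and law: "\<And>k::nat. prob {\<omega>\<in>space P. X \<omega> = real k} = m ^ k / fact k * exp (- m)"
    and m: "0 \<le> m"
  shows "prob {\<omega>\<in>space P. 2 \<le> X \<omega>} \<le> m\<^sup>2"
proof -
  have ev: "{\<omega>\<in>space P. X \<omega> = c} \<in> events" "{\<omega>\<in>space P. 2 \<le> X \<omega>} \<in> events" for c
    using X by measurable
  have "prob {\<omega>\<in>space P. X \<omega> = 0} + prob {\<omega>\<in>space P. X \<omega> = 1}
      = prob ({\<omega>\<in>space P. X \<omega> = 0} \<union> {\<omega>\<in>space P. X \<omega> = 1})"
    by (intro finite_measure_Union[symmetric] ev) auto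
  moreover have "\<dots> + prob {\<omega>\<in>space P. 2 \<le> X \<omega>}
      = prob ({\<omega>\<in>space P. X \<omega> = 0} \<union> {\<omega>\<in>space P. X \<omega> = 1} \<union> {\<omega>\<in>space P. 2 \<le> X \<omega>})"
    by (intro finite_measure_Union[symmetric] sets.Un ev) auto
  moreover have "\<dots> \<le> 1" by simp
  ultimately have "prob {\<omega>\<in>space P. 2 \<le> X \<omega>} \<le> 1 - exp (- m) * (1 + m)"
    using law[of 0] law[of 1] by (simp add: algebra_simps)
  also have "\<dots> \<le> 1 - (1 - m) * (1 + m)"
    using exp_ge_add_one_self[of "- m"] m by (intro diff_left_mono mult_right_mono) auto
  also have "\<dots> = m\<^sup>2"
    by (simp add: algebra_simps power2_eq_square)
  finally show ?thesis .
qed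

text \<open>One good level n suffices for each \<omega>. The bad events \<open>E n\<close> have
  probabilities tending to 0, so their intersection is null.\<close>

lemma poisson_no_multiple_points:
  assumes poisson: "poisson_point_process P S R \<zeta>"
    and no_fixed: "\<And>x. x \<in> space S \<Longrightarrow> AE \<omega> in P. measure (\<zeta> \<omega>) {x} = 0"
    and B: "B \<in> R"
  shows "AE \<omega> in P. \<exists>n. \<forall>j\<le>2 ^ n. measure (\<zeta> \<omega>) (B \<inter> cell n j) < 2"
proof -
  obtain \<mu> where sets_\<mu>: "sets \<mu> = sets S" and fin: "\<And>B. B \<in> R \<Longrightarrow> emeasure \<mu> B < \<infinity>"
      and law: "\<And>B k. B \<in> R \<Longrightarrow> prob {\<omega>\<in>space P. measure (\<zeta> \<omega>) B = real k} = measure \<mu> B ^ k / fact k * exp (- measure \<mu> B)"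
    using poisson unfolding poisson_point_process_def by blast
  have rm: "random_measure P S R \<zeta>"
    using poisson by (simp add: poisson_point_process_def)
  \<comment> \<open>The void probability of {x} is exp(-\<mu>{x}); it equals 1 because x is almost
    surely not charged.\<close>
  have diffuse: "emeasure \<mu> {x} = 0" if x: "x \<in> space S" for x
  proof -
    have "(\<lambda>\<omega>. measure (\<zeta> \<omega>) {x}) -` {0} \<inter> space P \<in> events"
      by (rule measurable_sets[OF random_measure_measurable[OF rm singleton_in_R[OF x]]]) simp
    also have "(\<lambda>\<omega>. measure (\<zeta> \<omega>) {x}) -` {0} \<inter> space P = {\<omega>\<in>space P. measure (\<zeta> \<omega>) {x} = real 0}"
      by auto
    finally have "prob {\<omega>\<in>space P. measure (\<zeta> \<omega>) {x} = real 0} = 1"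
      using no_fixed[OF x] by (subst prob_Collect_eq_1) simp_all
    then have "measure \<mu> {x} = 0"
      using law[OF singleton_in_R[OF x], of 0] by simp
    then show ?thesis
      using fin[OF singleton_in_R[OF x]] by (simp add: emeasure_eq_ennreal_measure less_top)
  qed
  define E where "E n = (\<Union>j\<le>2 ^ n. {\<omega>\<in>space P. 2 \<le> measure (\<zeta> \<omega>) (B \<inter> cell n j)})" for n
  have piece: "{\<omega>\<in>space P. 2 \<le> measure (\<zeta> \<omega>) (B \<inter> cell n j)} \<in> events" for n j
    using random_measure_measurable[OF rm cell_in_R[OF B]] by measurable
  then have E_event: "E n \<in> events" for n
    unfolding E_def by (intro sets.finite_UN) auto
  have E_le: "prob (E n) \<le> (\<Sum>j\<le>2 ^ n. (measure \<mu> (B \<inter> cell n j))\<^sup>2)" for n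
  proof -
    have "prob (E n) \<le> (\<Sum>j\<le>2 ^ n. prob {\<omega>\<in>space P. 2 \<le> measure (\<zeta> \<omega>) (B \<inter> cell n j)})"
      unfolding E_def using piece by (intro finite_measure_subadditive_finite) auto
    also have "\<dots> \<le> (\<Sum>j\<le>2 ^ n. (measure \<mu> (B \<inter> cell n j))\<^sup>2)"
      by (intro sum_mono poisson_at_least_2 random_measure_measurable[OF rm] law cell_in_R B measure_nonneg)
    finally show ?thesis .
  qed
  have "prob (\<Inter>n. E n) \<le> (\<Sum>j\<le>2 ^ n. (measure \<mu> (B \<inter> cell n j))\<^sup>2)" for n
    using E_event E_le[of n] finite_measure_mono[of "\<Inter>n. E n" "E n"] by (meson INF_lower UNIV_I order_trans)
  then have "prob (\<Inter>n. E n) \<le> 0"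
    by (intro LIMSEQ_le_const[OF sum_cell_squares_tendsto_0[OF sets_\<mu> B fin[OF B] diffuse]]) auto
  then have "prob (\<Inter>n. E n) = 0"
    using measure_nonneg[of P "\<Inter>n. E n"] by linarith
  moreover have "(\<Inter>n. E n) \<in> events"
    using E_event by (intro sets.countable_INT) auto
  ultimately have "AE \<omega> in P. \<omega> \<notin> (\<Inter>n. E n)"
    by (simp add: prob_eq_0)
  then show ?thesis
    using AE_space by eventually_elim (force simp: E_def not_le)
qed

text \<open>By the formula for the suprema, the Jordan parts are almost surely the masses of the
  atoms of each sign. Thus \<eta> is the difference of the two Poisson processes, and the Poisson
  mass of a cell bounds the weight of every atom in it.\<close>

proposition independent_increments_if_skellam:
  assumes skellam: "skellam_point_process P S R \<eta>" and no_fixed: "no_fixed_atoms P S \<eta>"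
  shows "simple_signed_point_process P S R \<eta>" and "independent_increments P R \<eta>"
proof -
  have rsm: "random_signed_measure P R \<eta>"
    using skellam by (simp add: skellam_point_process_def signed_point_process_def)
  obtain \<alpha> \<kappa> \<beta> \<sigma> where dec: "atomic_decomposition P S R \<eta> \<alpha> \<kappa> \<beta> \<sigma>"
      and \<alpha>: "AE \<omega> in P. \<forall>s. emeasure (\<alpha> s \<omega>) (space S) = 0"
      and \<beta>: "AE \<omega> in P. \<forall>s k. enat k < \<kappa> s \<omega> \<longrightarrow> \<beta> s k \<omega> \<in> \<nat>"
    using skellam by (auto simp: skellam_point_process_def signed_point_process_def)
  obtain \<eta>p \<eta>m where jordan: "jordan_decomposition P S R \<eta> \<eta>p \<eta>m"
      and poisson_p: "poisson_point_process P S R \<eta>p" and poisson_m: "poisson_point_process P S R \<eta>m"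
      and indep: "indep_var (locally_finite_algebra S R) \<eta>p (locally_finite_algebra S R) \<eta>m"
    using skellam by (auto simp: skellam_point_process_def)
  define \<zeta> where "\<zeta> s = (if s then \<eta>p else \<eta>m)" for s
  have poisson: "poisson_point_process P S R (\<zeta> s)" for s
    using poisson_p poisson_m by (simp add: \<zeta>_def)
  have SUP: "AE \<omega> in P. \<forall>s. \<forall>B\<in>R. measure (\<zeta> s \<omega>) B = (SUP E\<in>{E \<in> sets S. E \<subseteq> B}. if s then \<eta> \<omega> E else - \<eta> \<omega> E)"
    using jordan unfolding jordan_decomposition_def \<zeta>_def
    by (elim conjE) (erule eventually_mono, auto split: bool.split)
  have mass: "AE \<omega> in P. is_atomic (\<lambda>s. \<kappa> s \<omega>) (\<lambda>s k. \<beta> s k \<omega>) (\<lambda>s k. \<sigma> s k \<omega>) (\<eta> \<omega>) \<and>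
      (\<forall>s. \<forall>B\<in>R. measure (\<zeta> s \<omega>) B = atom_mass (\<lambda>s. \<kappa> s \<omega>) (\<lambda>s k. \<beta> s k \<omega>) (\<lambda>s k. \<sigma> s k \<omega>) s B)"
    using atomic_decomposition_AE[OF dec \<alpha>] SUP
  proof eventually_elim
    case (elim \<omega>)
    then show ?case using SUP_is_atomic[OF elim(1)] by simp
  qed
  show "independent_increments P R \<eta>"
  proof (rule independent_increments_AE_cong)
    show "independent_increments P R (\<lambda>\<omega> B. measure (\<eta>p \<omega>) B - measure (\<eta>m \<omega>) B)"
      using indep poisson_p poisson_m
      by (intro increments_diff_independent) (simp_all add: poisson_point_process_def)
    fix B assume B: "B \<in> R"
    show "(\<lambda>\<omega>. \<eta> \<omega> B) \<in> borel_measurable P"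
      by (rule random_signed_measure_measurable[OF rsm B])
    show "AE \<omega> in P. measure (\<eta>p \<omega>) B - measure (\<eta>m \<omega>) B = \<eta> \<omega> B"
      using mass
    proof eventually_elim
      case (elim \<omega>)
      then have "measure (\<zeta> True \<omega>) B - measure (\<zeta> False \<omega>) B = \<eta> \<omega> B"
        using B is_atomicD(5)[OF conjunct1[OF elim] B] by simp
      then show ?case by (simp add: \<zeta>_def)
    qed
  qed
  have \<zeta>_no_fixed: "AE \<omega> in P. measure (\<zeta> s \<omega>) {x} = 0" if x: "x \<in> space S" for s x
  proof -
    have "AE \<omega> in P. \<eta> \<omega> {x} = 0"
      using no_fixed x by (simp add: no_fixed_atoms_def)
    then show ?thesis
      using SUP mass
    proof eventually_elim
      case (elim \<omega>)
      have "\<eta> \<omega> {} = 0"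
        using is_atomicD(5)[OF conjunct1[OF elim(3)] empty_sets] by (simp add: atom_mass_def atom_indices_def)
      \<comment> \<open>Only {} and {x} are subsets of {x}, and \<eta> vanishes on both, so each
        Jordan part is 0 at x and not merely their difference.\<close>
      then have "(if s then \<eta> \<omega> E else - \<eta> \<omega> E) = 0" if "E \<subseteq> {x}" for E
        using that elim(1) by (auto simp: subset_singleton_iff)
      then have "(SUP E\<in>{E \<in> sets S. E \<subseteq> {x}}. if s then \<eta> \<omega> E else - \<eta> \<omega> E) = (SUP E\<in>{E \<in> sets S. E \<subseteq> {x}}. 0)"
        by (intro SUP_cong refl) auto
      also have "\<dots> = 0"
        by (intro cSUP_const) auto
      finally show ?case
        using elim(2) singleton_in_R[OF x] by simp
    qed
  qed
  obtain A where A: "range A \<subseteq> R" "incseq A" "(\<Union>n::nat. A n) = space S"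
    by (rule localizing)
  have A_R: "A l \<in> R" for l using A(1) by blast
  \<comment> \<open>The exceptional null sets are countably many, one for each sign and each member
    of the localizing sequence, and these members together contain every atom.\<close>
  have "AE \<omega> in P. \<forall>l s. \<exists>n. \<forall>j\<le>2 ^ n. measure (\<zeta> s \<omega>) (A l \<inter> cell n j) < 2"
    using poisson_no_multiple_points[OF poisson \<zeta>_no_fixed A_R]
    by (simp add: AE_all_countable)
  then have one: "AE \<omega> in P. \<forall>s k. enat k < \<kappa> s \<omega> \<longrightarrow> \<beta> s k \<omega> = 1"
    using mass \<beta>
  proof eventually_elim
    case (elim \<omega>)
    show ?case
    proof (intro allI impI)
      fix s k assume k: "enat k < \<kappa> s \<omega>"
      note atomic = conjunct1[OF elim(2)]
      let ?x = "\<sigma> s k \<omega>"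
      have x: "?x \<in> space S"
        using is_atomicD(1)[OF atomic k] .
      then obtain l where l: "?x \<in> A l" using A(3) by blast
      obtain n where n: "\<And>j. j \<le> 2 ^ n \<Longrightarrow> measure (\<zeta> s \<omega>) (A l \<inter> cell n j) < 2"
        using elim(1) by blast
      let ?C = "A l \<inter> cell n (idx n ?x)"
      have C: "?C \<in> R" by (rule cell_in_R[OF A_R])
      have "\<beta> s k \<omega> \<le> measure (\<zeta> s \<omega>) ?C"
        using le_atom_mass[OF atomic C k] elim(2) C l x by (simp add: cell_def)
      also have "\<dots> < 2"
        using n idx_le[OF x] by blast
      finally have "\<beta> s k \<omega> < 2" .
      \<comment> \<open>Integrality of the weights, part of being a signed point process, leaves 1
        as the only value between 0 and 2.\<close>
      moreover have "\<beta> s k \<omega> \<in> \<nat>" "0 < \<beta> s k \<omega>"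
        using elim(3) k is_atomicD(2)[OF atomic k] by auto
      ultimately show "\<beta> s k \<omega> = 1"
        by (auto elim!: Nats_cases)
    qed
  qed
  show "simple_signed_point_process P S R \<eta>"
    unfolding simple_signed_point_process_def using rsm dec \<alpha> one by blast
qed

end

theorem proposition3p2:
  fixes P :: "'w measure" and S :: "'a measure" and R :: "'a set set"
    and \<xi> \<eta> :: "'w \<Rightarrow> 'a set \<Rightarrow> real"
  assumes "prob_space P" and "localized_borel_space S R"
  shows "(simple_signed_point_process P S R \<xi> \<and> independent_increments P R \<xi> \<and>
            no_fixed_atoms P S \<xi> \<longrightarrow>
          skellam_point_process P S R \<xi>) \<and>
         (skellam_point_process P S R \<eta> \<and> no_fixed_atoms P S \<eta> \<longrightarrow>
          simple_signed_point_process P S R \<eta> \<and> independent_increments P R \<eta>)"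
proof -
  interpret localized_prob_space P S R
    using assms by (rule localized_prob_space.intro)
  show ?thesis
    using skellam_if_independent_increments independent_increments_if_skellam by blast
qed

end
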